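(* Let $u^0\in L^1(\mathbb{R})\cap L^\infty(\mathbb{R})$ and $v^0\in L^1(\mathbb{R})$, let $\alpha\in[0,\frac12)$, and let $r>0$ be a constant independent of $h$ with $r\|u^0\|_{L^\infty(\mathbb{R})}\le\frac12$. For each $h>0$ let $u_h,v_h$ be the step functions produced by the numerical scheme described in the context for the system $$u_t+(u^2)_x=0,\qquad v_t+(uv)_x=0,$$ with parameters $h,r,\alpha$ and initial data $u^0,v^0$. Then the scheme is consistent in the sense of distributions, of order one in $h$: for all $\phi,\psi\in\mathcal{C}_c^\infty(\mathbb{R}\times(0,\infty))$, $$\int\left[u_h\phi_t+(u_h)^2\phi_x\right]dx\,dt=O(h)\quad\text{and}\quad\int\left[v_h\psi_t+u_hv_h\psi_x\right]dx\,dt=O(h)\qquad\text{as }h\to0;$$ in particular both integrals tend to $0$ as $h\to0$ (the implied constants may depend on the test functions).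
   Context: Numerical scheme for $u_t+(u^2)_x=0$, $v_t+(uv)_x=0$, with space step $h>0$, CFL parameter $r>0$, and averaging parameter $\alpha\in[0,\frac12)$ (independent of $h$). Put $I_i=(ih-\frac h2,ih+\frac h2)$ for $i\in\mathbb{Z}$ and $t_n=nrh$ for integers $n\ge0$. For $a<b$ put $L(a,b)=\max(0,\min(1,b)-\max(0,a))$, i.e. the length of $[0,1]\cap[a,b]$. Initialization: $u_i^0=\frac1h\int_{I_i}u^0\,dx$, $v_i^0=\frac1h\int_{I_i}v^0\,dx$. Given $(u_i^n,v_i^n)_{i\in\mathbb{Z}}$, first (transport with velocity $u$) put $$\overline u_i=u_{i-1}^nL(-1+ru_{i-1}^n,ru_{i-1}^n)+u_i^nL(ru_i^n,1+ru_i^n)+u_{i+1}^nL(1+ru_{i+1}^n,2+ru_{i+1}^n),$$ $$\overline v_i=v_{i-1}^nL(-1+ru_{i-1}^n,ru_{i-1}^n)+v_i^nL(ru_i^n,1+ru_i^n)+v_{i+1}^nL(1+ru_{i+1}^n,2+ru_{i+1}^n),$$ then (averaging) $$u_i^{n+1}=\alpha\overline u_{i-1}+(1-2\alpha)\overline u_i+\alpha\overline u_{i+1},\qquad v_i^{n+1}=\alpha\overline v_{i-1}+(1-2\alpha)\overline v_i+\alpha\overline v_{i+1}.$$ (For $\alpha=0$ this is $u_i^{n+1}=\overline u_i$, $v_i^{n+1}=\overline v_i$.) The step functions $u_h,v_h$ are defined (almost everywhere) on $\mathbb{R}\times(0,\infty)$ by $u_h(x,t)=u_i^n$ and $v_h(x,t)=v_i^n$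 for $(x,t)\in I_i\times(t_n,t_{n+1})$. *)

theory Defs
  imports "HOL-Analysis.Analysis" "HOL-Probability.Essential_Supremum" "HOL-Library.Landau_Symbols"
begin

fun higher_differentiable_on ::
    "'a::real_normed_vector set \<Rightarrow> ('a \<Rightarrow> 'b::real_normed_vector) \<Rightarrow> nat \<Rightarrow> bool" where
  "higher_differentiable_on S f 0 \<longleftrightarrow> continuous_on S f"
| "higher_differentiable_on S f (Suc k) \<longleftrightarrow>
     (\<forall>x\<in>S. f differentiable at x) \<and>
     (\<forall>v. higher_differentiable_on S (\<lambda>x. frechet_derivative f (at x) v) k)"

definition smooth_on :: "'a::real_normed_vector set \<Rightarrow> ('a \<Rightarrow> 'b::real_normed_vector) \<Rightarrow> bool" where
  "smooth_on S f \<longleftrightarrow> (\<forall>k. higher_differentiable_on S f k)"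

text \<open>For open \<open>S\<close>, the elements of \<open>C\<^sub>c\<^sup>\<infinity>(S)\<close> are represented by their extensions by zero to
  the whole space.\<close>

definition test_functions :: "'a::real_normed_vector set \<Rightarrow> ('a \<Rightarrow> real) set" where
  "test_functions S =
     {\<phi>. smooth_on S \<phi> \<and> compact (closure {z. \<phi> z \<noteq> 0}) \<and> closure {z. \<phi> z \<noteq> 0} \<subseteq> S}"

text \<open>Points of the half-plane are written \<open>(x, t)\<close>, space first.\<close>

definition half_plane :: "(real \<times> real) set" where
  "half_plane = UNIV \<times> {0<..}"

definition dx :: "(real \<times> real \<Rightarrow> real) \<Rightarrow> real \<times> real \<Rightarrow> real" where
  "dx \<phi> = (\<lambda>(x, t). deriv (\<lambda>y. \<phi> (y, t)) x)"

definition dt :: "(real \<times> real \<Rightarrow> real) \<Rightarrow> real \<times> real \<Rightarrow> real" where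
  "dt \<phi> = (\<lambda>(x, t). deriv (\<lambda>s. \<phi> (x, s)) t)"

definition Linf_norm :: "(real \<Rightarrow> real) \<Rightarrow> ereal" where
  "Linf_norm f = esssup lebesgue (\<lambda>x. ereal \<bar>f x\<bar>)"

definition cell :: "real \<Rightarrow> int \<Rightarrow> real set" where
  "cell h i = {of_int i * h - h / 2 <..< of_int i * h + h / 2}"

definition time_level :: "real \<Rightarrow> real \<Rightarrow> nat \<Rightarrow> real" where
  "time_level r h n = of_nat n * r * h"

definition cell_average :: "real \<Rightarrow> (real \<Rightarrow> real) \<Rightarrow> int \<Rightarrow> real" where
  "cell_average h f i = 1 / h * (LINT x:cell h i|lebesgue. f x)"

definition overlap :: "real \<Rightarrow> real \<Rightarrow> real" where
  "overlap a b = max 0 (min 1 b - max 0 a)"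

definition transport :: "real \<Rightarrow> (int \<Rightarrow> real) \<Rightarrow> (int \<Rightarrow> real) \<Rightarrow> int \<Rightarrow> real" where
  "transport r u w i =
       w (i - 1) * overlap (- 1 + r * u (i - 1)) (r * u (i - 1))
     + w i * overlap (r * u i) (1 + r * u i)
     + w (i + 1) * overlap (1 + r * u (i + 1)) (2 + r * u (i + 1))"

definition averaging :: "real \<Rightarrow> (int \<Rightarrow> real) \<Rightarrow> int \<Rightarrow> real" where
  "averaging \<alpha> w i = \<alpha> * w (i - 1) + (1 - 2 * \<alpha>) * w i + \<alpha> * w (i + 1)"

primrec scheme_u :: "real \<Rightarrow> real \<Rightarrow> (real \<Rightarrow> real) \<Rightarrow> real \<Rightarrow> nat \<Rightarrow> int \<Rightarrow> real" where
  "scheme_u r \<alpha> u0 h 0 = cell_average h u0"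
| "scheme_u r \<alpha> u0 h (Suc n) =
     averaging \<alpha> (transport r (scheme_u r \<alpha> u0 h n) (scheme_u r \<alpha> u0 h n))"

primrec scheme_v ::
    "real \<Rightarrow> real \<Rightarrow> (real \<Rightarrow> real) \<Rightarrow> (real \<Rightarrow> real) \<Rightarrow> real \<Rightarrow> nat \<Rightarrow> int \<Rightarrow> real" where
  "scheme_v r \<alpha> u0 v0 h 0 = cell_average h v0"
| "scheme_v r \<alpha> u0 v0 h (Suc n) =
     averaging \<alpha> (transport r (scheme_u r \<alpha> u0 h n) (scheme_v r \<alpha> u0 v0 h n))"

text \<open>On the null set of cell boundaries the step function takes the value of the cell to the
  right of (respectively above) the boundary.\<close>

definition step_function ::
    "real \<Rightarrow> real \<Rightarrow> (nat \<Rightarrow> int \<Rightarrow> real) \<Rightarrow> real \<times> real \<Rightarrow> real" where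
  "step_function r h w = (\<lambda>(x, t). w (nat \<lfloor>t / (r * h)\<rfloor>) \<lfloor>x / h + 1 / 2\<rfloor>)"

lemma step_function_on_cell:
  assumes "r > 0" "h > 0" "x \<in> cell h i" "t \<in> {time_level r h n <..< time_level r h (Suc n)}"
  shows "step_function r h w (x, t) = w n i"
proof -
  have "\<lfloor>x / h + 1 / 2\<rfloor> = i"
    using assms by (intro floor_unique) (auto simp: cell_def field_simps)
  moreover have "\<lfloor>t / (r * h)\<rfloor> = int n"
    using assms by (intro floor_unique) (auto simp: time_level_def field_simps)
  ultimately show ?thesis
    by (simp add: step_function_def)
qed

definition step_u :: "real \<Rightarrow> real \<Rightarrow> (real \<Rightarrow> real) \<Rightarrow> real \<Rightarrow> real \<times> real \<Rightarrow> real" where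
  "step_u r \<alpha> u0 h = step_function r h (scheme_u r \<alpha> u0 h)"

definition step_v ::
    "real \<Rightarrow> real \<Rightarrow> (real \<Rightarrow> real) \<Rightarrow> (real \<Rightarrow> real) \<Rightarrow> real \<Rightarrow> real \<times> real \<Rightarrow> real" where
  "step_v r \<alpha> u0 v0 h = step_function r h (scheme_v r \<alpha> u0 v0 h)"

definition integrand_u ::
    "real \<Rightarrow> real \<Rightarrow> (real \<Rightarrow> real) \<Rightarrow> (real \<times> real \<Rightarrow> real) \<Rightarrow> real \<Rightarrow> real \<times> real \<Rightarrow> real" where
  "integrand_u r \<alpha> u0 \<phi> h z =
     step_u r \<alpha> u0 h z * dt \<phi> z + (step_u r \<alpha> u0 h z)\<^sup>2 * dx \<phi> z"

definition integrand_v ::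
    "real \<Rightarrow> real \<Rightarrow> (real \<Rightarrow> real) \<Rightarrow> (real \<Rightarrow> real) \<Rightarrow> (real \<times> real \<Rightarrow> real) \<Rightarrow> real
      \<Rightarrow> real \<times> real \<Rightarrow> real" where
  "integrand_v r \<alpha> u0 v0 \<psi> h z =
     step_v r \<alpha> u0 v0 h z * dt \<psi> z + step_u r \<alpha> u0 h z * step_v r \<alpha> u0 v0 h z * dx \<psi> z"

end

theory Submission imports Defs begin

text \<open>
  The scheme satisfies an exact discrete duality. One step maps a sequence \<open>w\<close> to the averaging of
  its transport, and pairing the result with samples \<open>g i = \<phi> (i * h, t)\<close> is the same as pairing \<open>w\<close>
  with the adjoint step applied to \<open>g\<close> (\<open>averaging_transport_adjoint\<close>). The adjoint step
  acts on a smooth function, so its result can be expanded: it equals \<open>g i + r * u i * h * dx \<phi>\<close> up to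
  \<open>O(h\<^sup>2)\<close>, uniformly in \<open>u\<close> (\<open>transport_adjoint_consistent\<close>). All differences thus fall on the test
  function rather than on the numerical solution.

  The integral of the weak form is a finite sum over space-time cells. On each cell it
  agrees with \<open>h * w\<close> times \<open>\<phi> (x, t + r * h) - \<phi> (x, t) + r * u * h * dx \<phi> (x, t + r * h)\<close> up to
  \<open>O(h\<^sup>3) * \<bar>w\<bar>\<close> (\<open>cell_weak_form_error\<close>). By duality the sum of these terms over a time
  level is a difference of consecutive values of the pairing of \<open>w\<close> with \<open>\<phi>\<close>, up to an error of the
  same size. The differences telescope to zero because \<open>\<phi>\<close> has compact support in the
  open half-plane. What is left are \<open>O(1 / h)\<close> time steps, each with an error \<open>O(h\<^sup>3)\<close> times the
  \<open>l1\<close> norm of \<open>w\<close>, and \<open>h\<close> times this norm stays bounded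
  (\<open>averaging_transport_L1\<close>, \<open>cell_average_summable\<close>). The total is \<open>O(h)\<close>.

  The expansion and the \<open>l1\<close> bound need transport weights that are nonnegative with sum \<open>1\<close>, that
  is, a Courant number \<open>\<bar>r * u\<bar> \<le> 1\<close>. The bound \<open>1 / 2\<close> reproduces itself from step to step
  (\<open>averaging_transport_stable\<close>): in units of \<open>1 / r\<close>, what enters a cell from its neighbours
  and what stays in it have modulus at most \<open>1 / 4\<close> each.

  The second equation is linear in \<open>v\<close> with velocity \<open>u\<close>, and the first one is the same equation
  with \<open>u\<close> in place of \<open>v\<close>; so one estimate (\<open>averaging_transport_weak_error\<close>) serves both.
\<close>

section \<open>Test functions\<close>

lemma has_derivative_0_outside_support:
  assumes "z \<notin> closure {z. \<phi> z \<noteq> (0 :: real)}"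
  shows "(\<phi> has_derivative (\<lambda>_. 0)) (at z)"
proof (rule has_derivative_transform_within_open)
  show "((\<lambda>_. 0) has_derivative (\<lambda>_. 0)) (at z)" by simp
  show "open (- closure {z. \<phi> z \<noteq> 0})" by auto
  show "z \<in> - closure {z. \<phi> z \<noteq> 0}" using assms by auto
  show "0 = \<phi> y" if "y \<in> - closure {z. \<phi> z \<noteq> 0}" for y
    using that closure_subset[of "{z. \<phi> z \<noteq> 0}"] by auto
qed

lemma test_function_differentiable:
  assumes "\<phi> \<in> test_functions S"
  shows "\<phi> differentiable (at z)"
proof (cases "z \<in> S")
  case True
  have "higher_differentiable_on S \<phi> (Suc 0)"
    using assms unfolding test_functions_def smooth_on_def by blast
  then show ?thesis using True by simp
next
  case False
  then have "z \<notin> closure {z. \<phi> z \<noteq> 0}"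
    using assms by (auto simp: test_functions_def)
  from has_derivative_0_outside_support[OF this] show ?thesis
    by (rule differentiableI)
qed

lemma test_function_continuous_on:
  "\<phi> \<in> test_functions S \<Longrightarrow> continuous_on A \<phi>"
  by (meson continuous_at_imp_continuous_on differentiable_imp_continuous_within
      test_function_differentiable)

text \<open>Differentiation does not enlarge the support, because a function vanishes near every point
  outside its support. So test functions are closed under directional derivatives, and each
  bound below for test functions also serves their partial derivatives.\<close>

lemma test_function_directional_derivative:
  assumes "\<phi> \<in> test_functions S"
  shows "(\<lambda>z. frechet_derivative \<phi> (at z) v) \<in> test_functions S"
proof -
  let ?g = "\<lambda>z. frechet_derivative \<phi> (at z) v"
  have "{z. ?g z \<noteq> 0} \<subseteq> closure {z. \<phi> z \<noteq> 0}"
  proof (rule subsetI, rule ccontr)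
    fix z assume z: "z \<in> {z. ?g z \<noteq> 0}" "z \<notin> closure {z. \<phi> z \<noteq> 0}"
    from has_derivative_0_outside_support[OF z(2)]
    have "frechet_derivative \<phi> (at z) = (\<lambda>_. 0)"
      by (rule frechet_derivative_at[symmetric])
    with z(1) show False by simp
  qed
  then have sub: "closure {z. ?g z \<noteq> 0} \<subseteq> closure {z. \<phi> z \<noteq> 0}"
    by (simp add: closure_minimal)
  have cpt: "compact (closure {z. \<phi> z \<noteq> 0})" and inS: "closure {z. \<phi> z \<noteq> 0} \<subseteq> S"
    using assms by (auto simp: test_functions_def)
  have "compact (closure {z. ?g z \<noteq> 0})"
    using compact_Int_closed[OF cpt closed_closure] sub by (metis inf.absorb2)
  moreover have "higher_differentiable_on S \<phi> (Suc k)" for k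
    using assms unfolding test_functions_def smooth_on_def by blast
  then have "smooth_on S ?g" unfolding smooth_on_def higher_differentiable_on.simps by blast
  ultimately show ?thesis using sub inS by (auto simp: test_functions_def)
qed

lemma test_function_bounded:
  assumes "\<phi> \<in> test_functions S"
  obtains B where "\<And>z. \<bar>\<phi> z\<bar> \<le> B"
proof -
  let ?K = "closure {z. \<phi> z \<noteq> 0}"
  have "compact (\<phi> ` ?K)"
    using assms test_function_continuous_on[OF assms]
    by (intro compact_continuous_image) (auto simp: test_functions_def)
  then obtain B where B: "\<And>y. y \<in> \<phi> ` ?K \<Longrightarrow> \<bar>y\<bar> \<le> B"
    by (metis bounded_iff compact_imp_bounded real_norm_def)
  have "\<bar>\<phi> z\<bar> \<le> max B 0" for z
  proof (cases "\<phi> z = 0")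
    case False
    then have "z \<in> ?K" using closure_subset by fastforce
    then show ?thesis using B by fastforce
  qed simp
  then show ?thesis using that by blast
qed

text \<open>Every directional derivative is again a test function, hence bounded; a bound on the partial
  derivatives along a basis is a bound on the operator norm of the derivative.\<close>

lemma test_function_lipschitz:
  fixes \<phi> :: "'a::euclidean_space \<Rightarrow> real"
  assumes "\<phi> \<in> test_functions S"
  obtains L where "L-lipschitz_on UNIV \<phi>"
proof -
  let ?D = "\<lambda>z. frechet_derivative \<phi> (at z)"
  have "\<exists>B. \<forall>z. \<bar>?D z b\<bar> \<le> B" for b
    by (rule test_function_bounded[OF test_function_directional_derivative[OF assms, of b]]) blast
  then have "\<forall>b. \<exists>B. \<forall>z. \<bar>?D z b\<bar> \<le> B" by blast
  from choice[OF this] obtain B where B: "\<And>b z. \<bar>?D z b\<bar> \<le> B b" by blast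
  have der: "(\<phi> has_derivative ?D z) (at z)" for z
    using test_function_differentiable[OF assms] frechet_derivative_works by blast
  have on: "onorm (?D z) \<le> (\<Sum>b\<in>Basis. B b)" for z
  proof (rule onorm_le)
    fix w :: 'a
    have lin: "linear (?D z)" using der has_derivative_linear by blast
    have "?D z w = ?D z (\<Sum>b\<in>Basis. (w \<bullet> b) *\<^sub>R b)" by (simp add: euclidean_representation)
    also have "\<dots> = (\<Sum>b\<in>Basis. (w \<bullet> b) * ?D z b)"
      using lin by (simp add: linear_sum linear_scale)
    finally have "\<bar>?D z w\<bar> \<le> (\<Sum>b\<in>Basis. \<bar>(w \<bullet> b) * ?D z b\<bar>)"
      by (simp add: sum_abs)
    also have "\<dots> \<le> (\<Sum>b\<in>Basis. norm w * B b)"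
      unfolding abs_mult by (intro sum_mono mult_mono B Basis_le_norm) auto
    finally show "norm (?D z w) \<le> (\<Sum>b\<in>Basis. B b) * norm w"
      by (simp add: sum_distrib_left mult.commute)
  qed
  have "(\<Sum>b\<in>Basis. B b)-lipschitz_on UNIV \<phi>"
  proof (rule lipschitz_onI)
    fix x y
    show "dist (\<phi> x) (\<phi> y) \<le> (\<Sum>b\<in>Basis. B b) * dist x y"
      unfolding dist_norm
      by (rule differentiable_bound[where S = UNIV and f' = ?D])
         (use der on in \<open>auto simp: has_derivative_at_withinI\<close>)
    show "0 \<le> (\<Sum>b\<in>Basis. B b)"
      using B by (intro sum_nonneg) (meson abs_ge_zero order_trans)
  qed
  then show ?thesis using that by blast
qed

lemma test_function_partial_derivatives:
  assumes "\<phi> \<in> test_functions S"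
  shows "((\<lambda>y. \<phi> (y, t)) has_real_derivative dx \<phi> (x, t)) (at x)"
    and "((\<lambda>s. \<phi> (x, s)) has_real_derivative dt \<phi> (x, t)) (at t)"
    and "dx \<phi> \<in> test_functions S" and "dt \<phi> \<in> test_functions S"
proof -
  let ?D = "\<lambda>z. frechet_derivative \<phi> (at z)"
  have der: "(\<phi> has_derivative ?D z) (at z)" for z
    using test_function_differentiable[OF assms] frechet_derivative_works by blast
  have lin: "linear (?D z)" for z using der has_derivative_linear by blast
  have x: "((\<lambda>y. \<phi> (y, t)) has_real_derivative ?D (x, t) (1, 0)) (at x)" for x t
  proof -
    have e: "(\<lambda>h. ?D (x, t) (h, 0)) = (*) (?D (x, t) (1, 0))"
    proof
      fix h
      show "?D (x, t) (h, 0) = ?D (x, t) (1, 0) * h"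
        using linear_scale[OF lin, of "(x, t)" h "(1, 0)"] by simp
    qed
    show ?thesis
      unfolding has_field_derivative_def e[symmetric]
      by (rule has_derivative_compose[of "\<lambda>y. (y, t)" "\<lambda>h. (h, 0)" _ _ \<phi>, OF _ der])
         (auto intro!: derivative_eq_intros)
  qed
  have t: "((\<lambda>s. \<phi> (x, s)) has_real_derivative ?D (x, t) (0, 1)) (at t)" for x t
  proof -
    have e: "(\<lambda>h. ?D (x, t) (0, h)) = (*) (?D (x, t) (0, 1))"
    proof
      fix h
      show "?D (x, t) (0, h) = ?D (x, t) (0, 1) * h"
        using linear_scale[OF lin, of "(x, t)" h "(0, 1)"] by simp
    qed
    show ?thesis
      unfolding has_field_derivative_def e[symmetric]
      by (rule has_derivative_compose[of "\<lambda>s. (x, s)" "\<lambda>h. (0, h)" _ _ \<phi>, OF _ der])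
         (auto intro!: derivative_eq_intros)
  qed
  have dx: "dx \<phi> = (\<lambda>z. ?D z (1, 0))" and dt: "dt \<phi> = (\<lambda>z. ?D z (0, 1))"
    using DERIV_imp_deriv[OF x] DERIV_imp_deriv[OF t] by (auto simp: dx_def dt_def)
  show "((\<lambda>y. \<phi> (y, t)) has_real_derivative dx \<phi> (x, t)) (at x)"
    and "((\<lambda>s. \<phi> (x, s)) has_real_derivative dt \<phi> (x, t)) (at t)"
    using x t by (simp_all add: dx dt)
  show "dx \<phi> \<in> test_functions S" "dt \<phi> \<in> test_functions S"
    unfolding dx dt by (rule test_function_directional_derivative[OF assms])+
qed

lemma test_function_half_plane_support:
  assumes "\<phi> \<in> test_functions half_plane"
  obtains R where "R > 0" "\<And>x t. \<phi> (x, t) \<noteq> 0 \<Longrightarrow> \<bar>x\<bar> < R \<and> 0 < t \<and> t < R"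
proof -
  let ?K = "closure {z. \<phi> z \<noteq> 0}"
  have "bounded ?K" using assms by (auto simp: test_functions_def compact_imp_bounded)
  then obtain R where R: "R > 0" "\<And>z. z \<in> ?K \<Longrightarrow> norm z < R"
    by (metis bounded_normE_less)
  show ?thesis
  proof (rule that[OF R(1)])
    fix x t assume "\<phi> (x, t) \<noteq> 0"
    then have K: "(x, t) \<in> ?K" using closure_subset by fastforce
    then have "0 < t" using assms by (auto simp: test_functions_def half_plane_def)
    moreover have "\<bar>x\<bar> < R" "\<bar>t\<bar> < R"
      using R(2)[OF K] norm_fst_le[of x t] norm_snd_le[of t x] by auto
    ultimately show "\<bar>x\<bar> < R \<and> 0 < t \<and> t < R" by auto
  qed
qed

text \<open>All that the error estimate uses of a test function: one radius \<open>R\<close> beyond which it and its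
  first derivatives vanish, and one Lipschitz constant \<open>L\<close> for these derivatives, which stands in
  for bounds on the second derivatives.\<close>

lemma test_function_half_plane_constants:
  assumes "\<phi> \<in> test_functions half_plane"
  obtains R L where "R > 0"
    and "\<And>x t. \<phi> (x, t) \<noteq> 0 \<or> dt \<phi> (x, t) \<noteq> 0 \<or> dx \<phi> (x, t) \<noteq> 0 \<Longrightarrow> \<bar>x\<bar> < R \<and> 0 < t \<and> t < R"
    and "L \<ge> 0"
    and "\<And>x t y s. \<bar>dt \<phi> (x, t) - dt \<phi> (y, s)\<bar> \<le> L * (\<bar>x - y\<bar> + \<bar>t - s\<bar>)"
    and "\<And>x t y s. \<bar>dx \<phi> (x, t) - dx \<phi> (y, s)\<bar> \<le> L * (\<bar>x - y\<bar> + \<bar>t - s\<bar>)"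
proof -
  note D = test_function_partial_derivatives(3,4)[OF assms]
  obtain R1 where R1: "R1 > 0" "\<And>x t. \<phi> (x, t) \<noteq> 0 \<Longrightarrow> \<bar>x\<bar> < R1 \<and> 0 < t \<and> t < R1"
    using test_function_half_plane_support[OF assms] by blast
  obtain R2 where R2: "R2 > 0" "\<And>x t. dx \<phi> (x, t) \<noteq> 0 \<Longrightarrow> \<bar>x\<bar> < R2 \<and> 0 < t \<and> t < R2"
    using test_function_half_plane_support[OF D(1)] by blast
  obtain R3 where R3: "R3 > 0" "\<And>x t. dt \<phi> (x, t) \<noteq> 0 \<Longrightarrow> \<bar>x\<bar> < R3 \<and> 0 < t \<and> t < R3"
    using test_function_half_plane_support[OF D(2)] by blast
  obtain L1 where L1: "L1-lipschitz_on UNIV (dx \<phi>)" using test_function_lipschitz[OF D(1)] .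
  obtain L2 where L2: "L2-lipschitz_on UNIV (dt \<phi>)" using test_function_lipschitz[OF D(2)] .
  have pair: "dist (x, t) (y, s) \<le> \<bar>x - y\<bar> + \<bar>t - s\<bar>" for x t y s :: real
    by (simp add: dist_Pair_Pair dist_real_def sqrt_sum_squares_le_sum_abs[of "x - y" "t - s", simplified])
  show ?thesis
  proof (rule that[of "R1 + R2 + R3" "L1 + L2"])
    show "R1 + R2 + R3 > 0" using R1 R2 R3 by simp
    show "\<bar>x\<bar> < R1 + R2 + R3 \<and> 0 < t \<and> t < R1 + R2 + R3"
      if "\<phi> (x, t) \<noteq> 0 \<or> dt \<phi> (x, t) \<noteq> 0 \<or> dx \<phi> (x, t) \<noteq> 0" for x t
      using that R1(2)[of x t] R2(2)[of x t] R3(2)[of x t] R1(1) R2(1) R3(1) by linarith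
    have nn: "L1 \<ge> 0" "L2 \<ge> 0" using L1 L2 lipschitz_on_nonneg by blast+
    then show "L1 + L2 \<ge> 0" by simp
    show "\<bar>dt \<phi> (x, t) - dt \<phi> (y, s)\<bar> \<le> (L1 + L2) * (\<bar>x - y\<bar> + \<bar>t - s\<bar>)" for x t y s
    proof -
      have "\<bar>dt \<phi> (x, t) - dt \<phi> (y, s)\<bar> \<le> L2 * dist (x, t) (y, s)"
        using lipschitz_onD[OF L2, of "(x, t)" "(y, s)"] by (simp add: dist_real_def)
      also have "\<dots> \<le> (L1 + L2) * (\<bar>x - y\<bar> + \<bar>t - s\<bar>)"
        using nn by (intro mult_mono pair) auto
      finally show ?thesis .
    qed
    show "\<bar>dx \<phi> (x, t) - dx \<phi> (y, s)\<bar> \<le> (L1 + L2) * (\<bar>x - y\<bar> + \<bar>t - s\<bar>)" for x t y s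
    proof -
      have "\<bar>dx \<phi> (x, t) - dx \<phi> (y, s)\<bar> \<le> L1 * dist (x, t) (y, s)"
        using lipschitz_onD[OF L1, of "(x, t)" "(y, s)"] by (simp add: dist_real_def)
      also have "\<dots> \<le> (L1 + L2) * (\<bar>x - y\<bar> + \<bar>t - s\<bar>)"
        using nn by (intro mult_mono pair) auto
      finally show ?thesis .
    qed
  qed
qed

section \<open>One time step of the scheme\<close>

text \<open>The adjoint of \<open>w \<mapsto> transport r u w\<close> for the pairing \<open>\<Sum>i. g i * w i\<close>, provided that
  \<open>\<bar>r * u i\<bar> \<le> 1\<close>. Seen from a source cell \<open>i\<close>, its content is split among the cells \<open>i + 1\<close>, \<open>i\<close>
  and \<open>i - 1\<close> with nonnegative weights of sum 1, and the new value of \<open>g\<close> is the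
  corresponding mean.\<close>

definition transport_adjoint :: "real \<Rightarrow> (int \<Rightarrow> real) \<Rightarrow> (int \<Rightarrow> real) \<Rightarrow> int \<Rightarrow> real" where
  "transport_adjoint r u g i =
     max 0 (r * u i) * g (i + 1) + (1 - \<bar>r * u i\<bar>) * g i + max 0 (- (r * u i)) * g (i - 1)"

text \<open>A unit cell displaced by \<open>a\<close> with \<open>\<bar>a\<bar> \<le> 1\<close> meets at most one neighbour, so the three overlaps
  are the positive part of \<open>a\<close>, the remainder \<open>1 - \<bar>a\<bar>\<close>, and the negative part of \<open>a\<close>.\<close>

lemma transport_eq:
  assumes "\<And>i. \<bar>r * u i\<bar> \<le> 1"
  shows "transport r u w i = max 0 (r * u (i - 1)) * w (i - 1) + (1 - \<bar>r * u i\<bar>) * w i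
    + max 0 (- (r * u (i + 1))) * w (i + 1)"
proof -
  have "overlap (- 1 + a) a = max 0 a" "overlap a (1 + a) = 1 - \<bar>a\<bar>"
    "overlap (1 + a) (2 + a) = max 0 (- a)" if "\<bar>a\<bar> \<le> 1" for a :: real
    using that unfolding overlap_def by linarith+
  then show ?thesis using assms by (simp add: transport_def)
qed

lemma averaging_bounded:
  assumes "0 \<le> \<alpha>" "\<alpha> < 1 / 2" "\<And>i. \<bar>g i\<bar> \<le> B"
  shows "\<bar>averaging \<alpha> g i\<bar> \<le> B"
proof -
  have "\<bar>averaging \<alpha> g i\<bar> \<le> \<alpha> * B + (1 - 2 * \<alpha>) * B + \<alpha> * B"
    unfolding averaging_def using assms
    by (intro order_trans[OF abs_triangle_ineq] add_mono) (auto simp: abs_mult intro!: mult_left_mono)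
  then show ?thesis by (simp add: algebra_simps)
qed

text \<open>The maximum principle for \<open>u\<close>, which keeps the Courant number at most \<open>1 / 2\<close>. With
  \<open>a, b, c\<close> the values of \<open>r * u\<close> in three consecutive cells, the transported value times \<open>r\<close> is
  \<open>a * max 0 a + b * (1 - \<bar>b\<bar>) + c * max 0 (- c)\<close>. The first term lies in \<open>[0, 1 / 4]\<close>, the last in
  \<open>[- 1 / 4, 0]\<close>, and the middle one has modulus at most \<open>1 / 4\<close>.\<close>

lemma averaging_transport_stable:
  assumes "0 \<le> \<alpha>" "\<alpha> < 1 / 2" and u: "\<And>i. \<bar>r * u i\<bar> \<le> 1 / 2"
  shows "\<bar>r * averaging \<alpha> (transport r u u) i\<bar> \<le> 1 / 2"
proof -
  have 1: "\<bar>r * transport r u u i\<bar> \<le> 1 / 2" for i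
  proof -
    define a b c where "a = r * u (i - 1)" and "b = r * u i" and "c = r * u (i + 1)"
    have abc: "\<bar>a\<bar> \<le> 1 / 2" "\<bar>b\<bar> \<le> 1 / 2" "\<bar>c\<bar> \<le> 1 / 2"
      using u by (auto simp: a_def b_def c_def)
    have "transport r u u i = max 0 a * u (i - 1) + (1 - \<bar>b\<bar>) * u i + max 0 (- c) * u (i + 1)"
      unfolding a_def b_def c_def
      by (rule transport_eq[of r u u]) (rule order_trans[OF u], simp)
    then have eq: "r * transport r u u i = max 0 a * a + (1 - \<bar>b\<bar>) * b + max 0 (- c) * c"
      by (simp only: a_def b_def c_def distrib_left mult.left_commute mult.commute)
    have sq: "x * x \<le> 1 / 4" if "\<bar>x\<bar> \<le> 1 / 2" for x :: real
      using mult_mono[OF that that] by (simp add: abs_mult[symmetric])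
    have "0 \<le> max 0 a * a" "max 0 a * a \<le> 1 / 4" "max 0 (- c) * c \<le> 0" "- (1 / 4) \<le> max 0 (- c) * c"
      using sq[OF abc(1)] sq[OF abc(3)] by (auto simp: max_def mult_nonpos_nonneg)
    moreover have "\<bar>(1 - \<bar>b\<bar>) * b\<bar> \<le> 1 / 4"
    proof -
      have "(1 - \<bar>b\<bar>) * \<bar>b\<bar> \<le> 1 / 4"
        using zero_le_square[of "\<bar>b\<bar> - 1 / 2"] by (simp add: algebra_simps)
      then show ?thesis using abc(2) by (simp add: abs_mult)
    qed
    ultimately show ?thesis unfolding eq by linarith
  qed
  have "r * averaging \<alpha> (transport r u u) i = averaging \<alpha> (\<lambda>i. r * transport r u u i) i"
    by (simp add: averaging_def algebra_simps)
  then show ?thesis using averaging_bounded[OF assms(1,2) 1] by simp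
qed

lemma summable_on_shift: "(\<lambda>i. f (i + k)) summable_on UNIV \<longleftrightarrow> f summable_on (UNIV :: int set)"
  by (rule summable_on_reindex_bij_witness[where j = "\<lambda>i. i + k" and i = "\<lambda>i. i - k"]) auto

lemma infsum_shift: "(\<Sum>\<^sub>\<infinity>i. f (i + k)) = (\<Sum>\<^sub>\<infinity>i::int. f i)"
  by (rule infsum_reindex_bij_witness[where j = "\<lambda>i. i + k" and i = "\<lambda>i. i - k"]) auto

lemma summable_on_abs: "w summable_on A \<Longrightarrow> (\<lambda>i. \<bar>w i :: real\<bar>) summable_on A"
  using summable_on_iff_abs_summable_on_real[of w A] by simp

lemma summable_on_mult_bounded:
  fixes w g :: "'a \<Rightarrow> real"
  assumes "w summable_on A" and "\<And>i. \<bar>g i\<bar> \<le> B"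
  shows "(\<lambda>i. g i * w i) summable_on A"
proof -
  have "(\<lambda>i. B * \<bar>w i\<bar>) summable_on A"
    by (intro summable_on_cmult_right summable_on_abs assms(1))
  then have "(\<lambda>i. norm (g i * w i)) summable_on A"
    by (rule Infinite_Sum.abs_summable_on_comparison_test') (auto simp: abs_mult intro: mult_right_mono assms(2))
  then show ?thesis using summable_on_iff_abs_summable_on_real by blast
qed

lemma infsum_mult_bounded:
  fixes w g :: "'a \<Rightarrow> real"
  assumes w: "w summable_on A" and g: "\<And>i. \<bar>g i\<bar> \<le> B"
  shows "\<bar>\<Sum>\<^sub>\<infinity>i\<in>A. g i * w i\<bar> \<le> B * (\<Sum>\<^sub>\<infinity>i\<in>A. \<bar>w i\<bar>)"
proof -
  have gw: "(\<lambda>i. \<bar>g i * w i\<bar>) summable_on A"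
    by (rule summable_on_abs, rule summable_on_mult_bounded[OF assms])
  have "\<bar>\<Sum>\<^sub>\<infinity>i\<in>A. g i * w i\<bar> \<le> (\<Sum>\<^sub>\<infinity>i\<in>A. \<bar>g i * w i\<bar>)"
    using norm_infsum_bound[of "\<lambda>i. g i * w i" A] gw by simp
  also have "\<dots> \<le> (\<Sum>\<^sub>\<infinity>i\<in>A. B * \<bar>w i\<bar>)"
    using g by (intro infsum_mono gw summable_on_cmult_right summable_on_abs w) (auto simp: abs_mult intro: mult_right_mono)
  also have "\<dots> = B * (\<Sum>\<^sub>\<infinity>i\<in>A. \<bar>w i\<bar>)" by (rule infsum_cmult_right')
  finally show ?thesis .
qed

text \<open>Summation by parts: shifting the index moves each coupling between neighbours from the
  sequence \<open>w\<close> to the weight \<open>g\<close>. Both half steps of the scheme are three-point operators of this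
  form.\<close>

lemma three_point_summation_by_parts:
  fixes a b c w g :: "int \<Rightarrow> real"
  assumes w: "w summable_on UNIV" and g: "\<And>i. \<bar>g i\<bar> \<le> B"
    and abc: "\<And>i. \<bar>a i\<bar> \<le> 1" "\<And>i. \<bar>b i\<bar> \<le> 1" "\<And>i. \<bar>c i\<bar> \<le> 1"
  defines "w' \<equiv> \<lambda>i. a (i - 1) * w (i - 1) + b i * w i + c (i + 1) * w (i + 1)"
    and "g' \<equiv> \<lambda>i. a i * g (i + 1) + b i * g i + c i * g (i - 1)"
  shows "w' summable_on UNIV" and "(\<Sum>\<^sub>\<infinity>i. g i * w' i) = (\<Sum>\<^sub>\<infinity>i. g' i * w i)"
proof -
  note S = summable_on_shift[of _ "- 1", simplified] summable_on_shift[of _ 1]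
  note I = infsum_shift[of _ "- 1", simplified] infsum_shift[of _ 1]
  have s: "(\<lambda>i. a i * w i) summable_on UNIV" "(\<lambda>i. b i * w i) summable_on UNIV"
    "(\<lambda>i. c i * w i) summable_on UNIV"
    using summable_on_mult_bounded[OF w] abc by blast+
  show "w' summable_on UNIV"
    unfolding w'_def using s S(1)[of "\<lambda>i. a i * w i"] S(2)[of "\<lambda>i. c i * w i"]
    by (intro summable_on_add) auto
  have ga: "(\<lambda>i. g (i + 1) * (a i * w i)) summable_on UNIV"
    and gb: "(\<lambda>i. g i * (b i * w i)) summable_on UNIV"
    and gc: "(\<lambda>i. g (i - 1) * (c i * w i)) summable_on UNIV"
    by (rule summable_on_mult_bounded[where B = B], (rule s g)+)+
  have ga': "(\<lambda>i. g i * (a (i - 1) * w (i - 1))) summable_on UNIV"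
    using S(1)[of "\<lambda>i. g (i + 1) * (a i * w i)"] ga by simp
  have gc': "(\<lambda>i. g i * (c (i + 1) * w (i + 1))) summable_on UNIV"
    using S(2)[of "\<lambda>i. g (i - 1) * (c i * w i)"] gc by simp
  have "(\<Sum>\<^sub>\<infinity>i. g i * w' i) = (\<Sum>\<^sub>\<infinity>i. g i * (a (i - 1) * w (i - 1)))
      + (\<Sum>\<^sub>\<infinity>i. g i * (b i * w i)) + (\<Sum>\<^sub>\<infinity>i. g i * (c (i + 1) * w (i + 1)))"
    unfolding w'_def distrib_left
    by (simp only: infsum_add[OF summable_on_add[OF ga' gb] gc'] infsum_add[OF ga' gb])
  also have "\<dots> = (\<Sum>\<^sub>\<infinity>i. g (i + 1) * (a i * w i))
      + (\<Sum>\<^sub>\<infinity>i. g i * (b i * w i)) + (\<Sum>\<^sub>\<infinity>i. g (i - 1) * (c i * w i))"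
    using I(1)[of "\<lambda>i. g (i + 1) * (a i * w i)"] I(2)[of "\<lambda>i. g (i - 1) * (c i * w i)"] by simp
  also have "\<dots> = (\<Sum>\<^sub>\<infinity>i. g (i + 1) * (a i * w i) + g i * (b i * w i) + g (i - 1) * (c i * w i))"
    by (simp only: infsum_add[OF summable_on_add[OF ga gb] gc] infsum_add[OF ga gb])
  also have "\<dots> = (\<Sum>\<^sub>\<infinity>i. g' i * w i)"
    by (simp add: g'_def algebra_simps)
  finally show "(\<Sum>\<^sub>\<infinity>i. g i * w' i) = (\<Sum>\<^sub>\<infinity>i. g' i * w i)" .
qed

lemma averaging_transport_adjoint:
  assumes \<alpha>: "0 \<le> \<alpha>" "\<alpha> < 1 / 2" and u: "\<And>i. \<bar>r * u i\<bar> \<le> 1"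
    and w: "w summable_on UNIV" and g: "\<And>i. \<bar>g i\<bar> \<le> B"
  shows "averaging \<alpha> (transport r u w) summable_on UNIV"
    and "(\<Sum>\<^sub>\<infinity>i. g i * averaging \<alpha> (transport r u w) i)
      = (\<Sum>\<^sub>\<infinity>i. transport_adjoint r u (averaging \<alpha> g) i * w i)"
proof -
  have m: "\<bar>max 0 (r * u i)\<bar> \<le> 1" "\<bar>1 - \<bar>r * u i\<bar>\<bar> \<le> 1" "\<bar>max 0 (- (r * u i))\<bar> \<le> 1" for i
    using u[of i] by (auto simp: max_def abs_if split: if_splits)
  have T: "transport r u w = (\<lambda>i. max 0 (r * u (i - 1)) * w (i - 1) + (1 - \<bar>r * u i\<bar>) * w i
    + max 0 (- (r * u (i + 1))) * w (i + 1))"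
    using transport_eq[of r u w, OF u] by blast
  have 1: "transport r u w summable_on UNIV"
    unfolding T by (rule three_point_summation_by_parts[OF w g m])
  have A: "averaging \<alpha> f = (\<lambda>i. \<alpha> * f (i - 1) + (1 - 2 * \<alpha>) * f i + \<alpha> * f (i + 1))" for f
    by (auto simp: averaging_def)
  have c: "\<bar>\<alpha>\<bar> \<le> 1" "\<bar>1 - 2 * \<alpha>\<bar> \<le> 1" using \<alpha> by auto
  note P = three_point_summation_by_parts[OF 1 g, of "\<lambda>_. \<alpha>" "\<lambda>_. 1 - 2 * \<alpha>" "\<lambda>_. \<alpha>", OF c(1) c(2) c(1)]
  show "averaging \<alpha> (transport r u w) summable_on UNIV"
    unfolding A by (rule P(1))
  have "(\<Sum>\<^sub>\<infinity>i. g i * averaging \<alpha> (transport r u w) i) = (\<Sum>\<^sub>\<infinity>i. averaging \<alpha> g i * transport r u w i)"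
    unfolding A using P(2) by (simp only: add_ac)
  also have "\<dots> = (\<Sum>\<^sub>\<infinity>i. transport_adjoint r u (averaging \<alpha> g) i * w i)"
    unfolding T transport_adjoint_def
    by (rule three_point_summation_by_parts(2)[OF w averaging_bounded[OF \<alpha> g] m])
  finally show "(\<Sum>\<^sub>\<infinity>i. g i * averaging \<alpha> (transport r u w) i)
      = (\<Sum>\<^sub>\<infinity>i. transport_adjoint r u (averaging \<alpha> g) i * w i)" .
qed

text \<open>The step is positive, so it is dominated by its action on \<open>\<bar>w\<bar>\<close>; and it is conservative,
  since both the averaging and the adjoint transport fix the constant \<open>1\<close>. Hence it does not
  increase the \<open>l1\<close> norm.\<close>

lemma averaging_transport_L1:
  assumes \<alpha>: "0 \<le> \<alpha>" "\<alpha> < 1 / 2" and u: "\<And>i. \<bar>r * u i\<bar> \<le> 1"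
    and w: "w summable_on UNIV"
  shows "(\<Sum>\<^sub>\<infinity>i. \<bar>averaging \<alpha> (transport r u w) i\<bar>) \<le> (\<Sum>\<^sub>\<infinity>i. \<bar>w i\<bar>)"
proof -
  let ?P = "\<lambda>w. averaging \<alpha> (transport r u w)"
  note aw = summable_on_abs[OF w]
  note adj = averaging_transport_adjoint[of \<alpha> r u, OF \<alpha> u aw, of "\<lambda>_. 1" 1, simplified]
  have "(\<Sum>\<^sub>\<infinity>i. \<bar>?P w i\<bar>) \<le> (\<Sum>\<^sub>\<infinity>i. ?P (\<lambda>i. \<bar>w i\<bar>) i)"
  proof (rule infsum_mono)
    show "(\<lambda>i. \<bar>?P w i\<bar>) summable_on UNIV"
      by (rule summable_on_abs, rule averaging_transport_adjoint(1)[OF \<alpha> u w, of "\<lambda>_. 1" 1]) simp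
    show "?P (\<lambda>i. \<bar>w i\<bar>) summable_on UNIV" by (rule adj(1))
    have T: "\<bar>transport r u w i\<bar> \<le> transport r u (\<lambda>i. \<bar>w i\<bar>) i" for i
      unfolding transport_eq[of r u, OF u] using u
      by (intro order_trans[OF abs_triangle_ineq] add_mono) (auto simp: abs_mult)
    show "\<bar>?P w i\<bar> \<le> ?P (\<lambda>i. \<bar>w i\<bar>) i" for i
      unfolding averaging_def using \<alpha> T
      by (intro order_trans[OF abs_triangle_ineq] add_mono) (auto simp: abs_mult intro!: mult_left_mono)
  qed
  also have "\<dots> = (\<Sum>\<^sub>\<infinity>i. transport_adjoint r u (averaging \<alpha> (\<lambda>_. 1)) i * \<bar>w i\<bar>)"
    by (rule adj(2))
  also have "\<dots> = (\<Sum>\<^sub>\<infinity>i. \<bar>w i\<bar>)"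
  proof -
    have "transport_adjoint r u (averaging \<alpha> (\<lambda>_. 1)) i = 1" for i
      by (auto simp: transport_adjoint_def averaging_def max_def abs_if)
    then show ?thesis by simp
  qed
  finally show ?thesis .
qed

section \<open>Bounds along the iteration\<close>

lemma averaging_transport_iterates:
  fixes u w :: "nat \<Rightarrow> int \<Rightarrow> real"
  assumes \<alpha>: "0 \<le> \<alpha>" "\<alpha> < 1 / 2" and u: "\<And>n i. \<bar>r * u n i\<bar> \<le> 1"
    and w0: "w 0 summable_on UNIV"
    and w: "\<And>n. w (Suc n) = averaging \<alpha> (transport r (u n) (w n))"
  shows "w n summable_on UNIV" and "(\<Sum>\<^sub>\<infinity>i. \<bar>w n i\<bar>) \<le> (\<Sum>\<^sub>\<infinity>i. \<bar>w 0 i\<bar>)"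
proof (induction n)
  case 0
  case 1 show ?case by (rule w0)
next
  case 0
  case 2 show ?case by simp
next
  case (Suc n)
  case 1
  show ?case unfolding w
    using averaging_transport_adjoint(1)[of \<alpha> r "u n" "w n" "\<lambda>_. 0" 0, OF \<alpha> u Suc(1)] by simp
next
  case (Suc n)
  case 2
  show ?case unfolding w[of n]
    using averaging_transport_L1[of \<alpha> r "u n" "w n", OF \<alpha> u Suc(1)] Suc(2) by simp
qed

text \<open>The cells are disjoint and averaging over a cell does not increase the integral of the
  modulus, which makes the discrete \<open>l1\<close> norms of the initial data, weighted by \<open>h\<close>, bounded
  uniformly in \<open>h\<close>.\<close>

lemma cell_average_summable:
  assumes f: "integrable lebesgue f" and h: "h > 0"
  shows "cell_average h f summable_on UNIV"
    and "h * (\<Sum>\<^sub>\<infinity>i. \<bar>cell_average h f i\<bar>) \<le> (LINT x|lebesgue. \<bar>f x\<bar>)"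
proof -
  have meas: "cell h i \<in> sets lebesgue" for i by (simp add: cell_def)
  have si: "set_integrable lebesgue (cell h i) (\<lambda>x. \<bar>f x\<bar>)" for i
    unfolding set_integrable_def using f meas by (intro integrable_mult_indicator) auto
  have disj: "i = j" if "x \<in> cell h i" "x \<in> cell h j" for x i j
  proof -
    have "\<lfloor>x / h + 1 / 2\<rfloor> = k" if "x \<in> cell h k" for k
      using that h by (intro floor_unique) (auto simp: cell_def field_simps)
    then show ?thesis using that by blast
  qed
  have avg: "h * \<bar>cell_average h f i\<bar> \<le> (LINT x:cell h i|lebesgue. \<bar>f x\<bar>)" for i
  proof -
    have "h * \<bar>cell_average h f i\<bar> = \<bar>LINT x:cell h i|lebesgue. f x\<bar>"
      using h by (simp add: cell_average_def abs_mult)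
    also have "\<dots> \<le> (LINT x:cell h i|lebesgue. \<bar>f x\<bar>)"
      unfolding set_lebesgue_integral_def
      using integral_abs_bound[of lebesgue "\<lambda>x. indicat_real (cell h i) x *\<^sub>R f x"]
      by (simp add: abs_mult)
    finally show ?thesis .
  qed
  have fin: "h * (\<Sum>i\<in>A. \<bar>cell_average h f i\<bar>) \<le> (LINT x|lebesgue. \<bar>f x\<bar>)" if A: "finite A" for A
  proof -
    have "h * (\<Sum>i\<in>A. \<bar>cell_average h f i\<bar>) \<le> (\<Sum>i\<in>A. LINT x:cell h i|lebesgue. \<bar>f x\<bar>)"
      unfolding sum_distrib_left by (intro sum_mono avg)
    also have "\<dots> = (LINT x|lebesgue. (\<Sum>i\<in>A. indicat_real (cell h i) x *\<^sub>R \<bar>f x\<bar>))"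
      unfolding set_lebesgue_integral_def
      by (subst Bochner_Integration.integral_sum) (use si in \<open>auto simp: set_integrable_def\<close>)
    also have "\<dots> \<le> (LINT x|lebesgue. \<bar>f x\<bar>)"
    proof (rule integral_mono)
      show "integrable lebesgue (\<lambda>x. \<Sum>i\<in>A. indicat_real (cell h i) x *\<^sub>R \<bar>f x\<bar>)"
        using si by (intro Bochner_Integration.integrable_sum) (auto simp: set_integrable_def)
      show "integrable lebesgue (\<lambda>x. \<bar>f x\<bar>)" using f by auto
      show "(\<Sum>i\<in>A. indicat_real (cell h i) x *\<^sub>R \<bar>f x\<bar>) \<le> \<bar>f x\<bar>" for x
      proof (cases "\<exists>i\<in>A. x \<in> cell h i")
        case True
        then obtain i where i: "i \<in> A" "x \<in> cell h i" by blast
        have "(\<Sum>i\<in>A. indicat_real (cell h i) x *\<^sub>R \<bar>f x\<bar>) = (\<Sum>j\<in>{i}. \<bar>f x\<bar>)"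
          using i disj A by (intro sum.mono_neutral_cong_right) (auto simp: indicator_def)
        then show ?thesis by simp
      next
        case False
        then show ?thesis by (simp add: indicator_def)
      qed
    qed
    finally show ?thesis .
  qed
  have fin': "(\<Sum>i\<in>A. \<bar>cell_average h f i\<bar>) \<le> (LINT x|lebesgue. \<bar>f x\<bar>) / h" if "finite A" for A
    using fin[OF that] h by (simp add: field_simps)
  have s: "(\<lambda>i. \<bar>cell_average h f i\<bar>) summable_on UNIV"
    by (rule nonneg_bdd_above_summable_on) (auto simp: bdd_above_def intro!: fin')
  then show "cell_average h f summable_on UNIV"
    using summable_on_iff_abs_summable_on_real by auto
  have "(\<Sum>\<^sub>\<infinity>i. \<bar>cell_average h f i\<bar>) \<le> (LINT x|lebesgue. \<bar>f x\<bar>) / h"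
    by (rule infsum_le_finite_sums[OF s fin'])
  then show "h * (\<Sum>\<^sub>\<infinity>i. \<bar>cell_average h f i\<bar>) \<le> (LINT x|lebesgue. \<bar>f x\<bar>)"
    using h by (simp add: field_simps)
qed

lemma cell_average_bounded:
  assumes f: "integrable lebesgue f" and h: "h > 0" and B: "AE x in lebesgue. \<bar>f x\<bar> \<le> B"
  shows "\<bar>cell_average h f i\<bar> \<le> B"
proof -
  have meas: "cell h i \<in> sets lebesgue" by (simp add: cell_def)
  have em: "emeasure lebesgue (cell h i) = ennreal h" using h by (simp add: cell_def)
  then have m: "measure lebesgue (cell h i) = h" using h by (simp add: measure_def)
  have "\<bar>LINT x:cell h i|lebesgue. f x\<bar> \<le> (LINT x|lebesgue. indicat_real (cell h i) x *\<^sub>R \<bar>f x\<bar>)"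
    unfolding set_lebesgue_integral_def
    using integral_abs_bound[of lebesgue "\<lambda>x. indicat_real (cell h i) x *\<^sub>R f x"]
    by (simp add: abs_mult)
  also have "\<dots> \<le> (LINT x|lebesgue. indicat_real (cell h i) x *\<^sub>R B)"
  proof (rule integral_mono_AE)
    show "integrable lebesgue (\<lambda>x. indicat_real (cell h i) x *\<^sub>R \<bar>f x\<bar>)"
      using f meas by (intro integrable_mult_indicator) auto
    show "integrable lebesgue (\<lambda>x. indicat_real (cell h i) x *\<^sub>R B)"
      using meas em by (intro integrable_scaleR_left integrable_real_indicator) auto
    show "AE x in lebesgue. indicat_real (cell h i) x *\<^sub>R \<bar>f x\<bar> \<le> indicat_real (cell h i) x *\<^sub>R B"
      using B by eventually_elim (auto simp: indicator_def)
  qed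
  also have "\<dots> = h * B"
    using meas em m set_integral_const[of "cell h i" lebesgue B] by (simp add: set_lebesgue_integral_def)
  finally show ?thesis using h by (simp add: cell_average_def abs_mult field_simps)
qed

lemma scheme_u_bounded:
  assumes u0: "integrable lebesgue u0" and \<alpha>: "0 \<le> \<alpha>" "\<alpha> < 1 / 2"
    and r: "r > 0" and cfl: "ereal r * Linf_norm u0 \<le> ereal (1 / 2)" and h: "h > 0"
  shows "\<bar>r * scheme_u r \<alpha> u0 h n i\<bar> \<le> 1 / 2"
proof (induction n arbitrary: i)
  case 0
  have "AE x in lebesgue. ereal \<bar>u0 x\<bar> \<le> Linf_norm u0"
    unfolding Linf_norm_def by (rule esssup_AE)
  then have "AE x in lebesgue. \<bar>u0 x\<bar> \<le> 1 / (2 * r)"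
  proof eventually_elim
    case (elim x)
    have "ereal (r * \<bar>u0 x\<bar>) \<le> ereal r * Linf_norm u0"
      using ereal_mult_left_mono[OF elim, of "ereal r"] r by simp
    with cfl have "r * \<bar>u0 x\<bar> \<le> 1 / 2" using order_trans ereal_less_eq(3) by blast
    then show ?case using r by (simp add: field_simps)
  qed
  from cell_average_bounded[OF u0 h this]
  have "\<bar>cell_average h u0 i\<bar> \<le> 1 / (2 * r)" .
  then show ?case using r by (simp add: abs_mult field_simps)
next
  case (Suc n)
  show ?case unfolding scheme_u.simps by (rule averaging_transport_stable[OF \<alpha> Suc.IH])
qed

section \<open>Discretisation of the test function\<close>

lemma lipschitz_derivative_taylor:
  fixes f f' :: "real \<Rightarrow> real"
  assumes "\<And>x. (f has_real_derivative f' x) (at x)" and "\<And>x y. \<bar>f' x - f' y\<bar> \<le> L * \<bar>x - y\<bar>"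
    and "L \<ge> 0"
  shows "\<bar>f (x + d) - f x - d * f' x\<bar> \<le> L * d\<^sup>2"
proof -
  have "norm (f (x + d) - f x - ((x + d) - x) *\<^sub>R f' x) \<le> norm ((x + d) - x) * (L * \<bar>d\<bar>)"
  proof (rule vector_differentiable_bound_linearization
      [where S = "closed_segment x (x + d)" and f' = f' and ?x0.0 = x])
    show "(f has_vector_derivative f' y) (at y within closed_segment x (x + d))" for y
      using assms(1) has_real_derivative_iff_has_vector_derivative has_vector_derivative_at_within
      by blast
    show "norm (f' y - f' x) \<le> L * \<bar>d\<bar>" if "y \<in> closed_segment x (x + d)" for y
    proof -
      have "\<bar>y - x\<bar> \<le> \<bar>d\<bar>" using that by (auto simp: closed_segment_eq_real_ivl split: if_splits)
      then have "L * \<bar>y - x\<bar> \<le> L * \<bar>d\<bar>" using assms(3) by (rule mult_left_mono)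
      then show ?thesis using assms(2)[of y x] by simp
    qed
  qed auto
  then show ?thesis by (simp add: power2_eq_square mult.left_commute)
qed

text \<open>The heart of the consistency. Averaging samples of a smooth function changes them only by
  \<open>O(h\<^sup>2)\<close>, because the two first-order terms cancel. The adjoint transport then adds the upwind
  differences weighted by the positive and negative parts of \<open>r * u i\<close>. By the first-order expansion
  these sum up to \<open>r * u i * h * f'\<close>, the correct convection term, again up to \<open>O(h\<^sup>2)\<close>.\<close>

lemma transport_adjoint_consistent:
  fixes f f' :: "real \<Rightarrow> real"
  assumes f: "\<And>x. (f has_real_derivative f' x) (at x)" "\<And>x y. \<bar>f' x - f' y\<bar> \<le> L * \<bar>x - y\<bar>"
    and L: "L \<ge> 0"
    and \<alpha>: "0 \<le> \<alpha>" "\<alpha> < 1 / 2" and u: "\<bar>r * u i\<bar> \<le> 1"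
  shows "\<bar>transport_adjoint r u (averaging \<alpha> (\<lambda>i. f (of_int i * h))) i
    - (f (of_int i * h) + r * u i * h * f' (of_int i * h))\<bar> \<le> 2 * L * h\<^sup>2"
proof -
  let ?g = "\<lambda>i. f (of_int i * h)"
  let ?A = "averaging \<alpha> ?g"
  note T = lipschitz_derivative_taylor[OF f L]
  have nb: "\<bar>?g (j + 1) - ?g j - h * f' (of_int j * h)\<bar> \<le> L * h\<^sup>2"
    "\<bar>?g (j - 1) - ?g j + h * f' (of_int j * h)\<bar> \<le> L * h\<^sup>2" for j
    using T[of "of_int j * h" h] T[of "of_int j * h" "- h"] by (simp_all add: algebra_simps)
  have A: "\<bar>?A j - ?g j\<bar> \<le> L * h\<^sup>2" for j
  proof -
    have "?A j - ?g j = \<alpha> * ((?g (j + 1) - ?g j - h * f' (of_int j * h))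
        + (?g (j - 1) - ?g j + h * f' (of_int j * h)))"
      by (simp add: averaging_def algebra_simps)
    also have "\<bar>\<dots>\<bar> \<le> 1 / 2 * (L * h\<^sup>2 + L * h\<^sup>2)"
      unfolding abs_mult using \<alpha>
      by (intro mult_mono order_trans[OF abs_triangle_ineq add_mono[OF nb]]) auto
    finally show ?thesis by simp
  qed
  define p q where "p = max 0 (r * u i)" and "q = max 0 (- (r * u i))"
  have pq: "p \<ge> 0" "q \<ge> 0" "p + q = \<bar>r * u i\<bar>" "p - q = r * u i"
    by (auto simp: p_def q_def)
  define a0 a1 a2 where "a0 = ?A i - ?g i" and "a1 = ?A (i + 1) - ?g (i + 1)"
    and "a2 = ?A (i - 1) - ?g (i - 1)"
  define e1 e2 where "e1 = ?g (i + 1) - ?g i - h * f' (of_int i * h)"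
    and "e2 = ?g (i - 1) - ?g i + h * f' (of_int i * h)"
  have bnd: "\<bar>a0\<bar> \<le> L * h\<^sup>2" "\<bar>a1\<bar> \<le> L * h\<^sup>2" "\<bar>a2\<bar> \<le> L * h\<^sup>2" "\<bar>e1\<bar> \<le> L * h\<^sup>2" "\<bar>e2\<bar> \<le> L * h\<^sup>2"
    using A nb unfolding a0_def a1_def a2_def e1_def e2_def by blast+
  have T: "transport_adjoint r u ?A i = p * ?A (i + 1) + (1 - (p + q)) * ?A i + q * ?A (i - 1)"
    unfolding transport_adjoint_def pq(3)[symmetric] by (simp add: p_def q_def)
  have "transport_adjoint r u ?A i - (?g i + r * u i * h * f' (of_int i * h))
      = p * (a1 + e1) + (1 - (p + q)) * a0 + q * (a2 + e2)"
    unfolding T pq(4)[symmetric] a0_def a1_def a2_def e1_def e2_def by (simp add: algebra_simps)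
  also have "\<bar>\<dots>\<bar> \<le> p * (L * h\<^sup>2 + L * h\<^sup>2) + (1 - (p + q)) * (L * h\<^sup>2) + q * (L * h\<^sup>2 + L * h\<^sup>2)"
    using pq(1-3) u bnd
    by (intro order_trans[OF abs_triangle_ineq] add_mono)
       (auto simp: abs_mult intro!: mult_left_mono order_trans[OF abs_triangle_ineq] add_mono)
  also have "\<dots> = (1 + (p + q)) * (L * h\<^sup>2)" by (simp add: algebra_simps)
  also have "\<dots> \<le> 2 * (L * h\<^sup>2)"
    using pq(3) u L by (intro mult_right_mono) auto
  finally show ?thesis by simp
qed

section \<open>Integrals of step functions\<close>

text \<open>Half-open, so that the cells tile the half-plane \<open>t \<ge> 0\<close> and the step function takes its cell
  value on the whole of each cell, without exceptional null sets.\<close>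

definition space_time_cell :: "real \<Rightarrow> real \<Rightarrow> nat \<Rightarrow> int \<Rightarrow> (real \<times> real) set" where
  "space_time_cell r h n i =
     {of_int i * h - h / 2 ..< of_int i * h + h / 2} \<times> {time_level r h n ..< time_level r h (Suc n)}"

lemma in_space_time_cell_iff:
  assumes "r > 0" "h > 0"
  shows "(x, t) \<in> space_time_cell r h n i \<longleftrightarrow> \<lfloor>x / h + 1 / 2\<rfloor> = i \<and> \<lfloor>t / (r * h)\<rfloor> = int n"
  using assms
  by (auto simp: space_time_cell_def time_level_def floor_eq_iff field_simps)

lemma space_time_cell_measure:
  assumes "r > 0" "h > 0"
  shows "space_time_cell r h n i \<in> sets lborel"
    and "emeasure lborel (space_time_cell r h n i) < \<infinity>"
    and "measure lborel (space_time_cell r h n i) = h * (r * h)"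
proof -
  show "space_time_cell r h n i \<in> sets lborel"
    unfolding space_time_cell_def lborel_prod[symmetric] by auto
  have "emeasure lborel (space_time_cell r h n i)
      = emeasure lborel {of_int i * h - h / 2 ..< of_int i * h + h / 2}
        * emeasure lborel {time_level r h n ..< time_level r h (Suc n)}"
    unfolding space_time_cell_def
    by (subst lborel_prod[symmetric], subst lborel.emeasure_pair_measure_Times) auto
  also have "\<dots> = ennreal h * ennreal (r * h)"
    using assms by (simp add: time_level_def algebra_simps)
  also have "\<dots> = ennreal (h * (r * h))"
    using assms by (simp add: ennreal_mult)
  finally have e: "emeasure lborel (space_time_cell r h n i) = ennreal (h * (r * h))" .
  then show "emeasure lborel (space_time_cell r h n i) < \<infinity>" by simp
  show "measure lborel (space_time_cell r h n i) = h * (r * h)"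
    using e assms by (simp add: measure_def)
qed

lemma set_integrable_space_time_cell:
  fixes f :: "real \<times> real \<Rightarrow> real"
  assumes "r > 0" "h > 0" and f: "continuous_on UNIV f"
  shows "set_integrable lborel (space_time_cell r h n i) f"
proof (rule set_integrable_subset)
  let ?C = "{of_int i * h - h / 2 .. of_int i * h + h / 2} \<times> {time_level r h n .. time_level r h (Suc n)}"
  show "set_integrable lborel ?C f"
    unfolding set_integrable_def
    by (rule borel_integrable_compact) (auto intro: compact_Times continuous_on_subset[OF f])
  show "space_time_cell r h n i \<in> sets lborel" by (rule space_time_cell_measure[OF assms(1,2)])
  show "space_time_cell r h n i \<subseteq> ?C" by (auto simp: space_time_cell_def)
qed

lemma space_time_cell_integral_approx:
  fixes f :: "real \<times> real \<Rightarrow> real"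
  assumes rh: "r > 0" "h > 0" and f: "continuous_on UNIV f"
    and c: "\<And>z. z \<in> space_time_cell r h n i \<Longrightarrow> \<bar>f z - c\<bar> \<le> e"
  shows "\<bar>(LINT z:space_time_cell r h n i|lborel. f z) - h * (r * h) * c\<bar> \<le> h * (r * h) * e"
proof -
  let ?Q = "space_time_cell r h n i"
  note m = space_time_cell_measure[OF rh, of n i]
  have k: "set_integrable lborel ?Q (\<lambda>_. k :: real)" for k
    by (rule set_integrable_space_time_cell[OF rh]) simp
  have I: "(LINT z:?Q|lborel. k) = h * (r * h) * k" for k :: real
    using m by (subst set_integral_const) auto
  have fi: "set_integrable lborel ?Q f" by (rule set_integrable_space_time_cell[OF rh f])
  have "(LINT z:?Q|lborel. f z) \<le> (LINT z:?Q|lborel. c + e)"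
    using c by (intro set_integral_mono fi k) (force simp: abs_le_iff)
  moreover have "(LINT z:?Q|lborel. c - e) \<le> (LINT z:?Q|lborel. f z)"
    using c by (intro set_integral_mono fi k) (force simp: abs_le_iff)
  ultimately show ?thesis unfolding I by (simp add: abs_le_iff algebra_simps)
qed

text \<open>The compact support leaves finitely many cells. The margin of one \<open>h\<close> in the bound on \<open>K\<close>
  covers the cells which are only partly inside the support.\<close>

lemma step_function_integral:
  fixes f g :: "real \<times> real \<Rightarrow> real" and a b :: "nat \<Rightarrow> int \<Rightarrow> real"
  assumes rh: "r > 0" "h > 0" and f: "continuous_on UNIV f" and g: "continuous_on UNIV g"
    and supp: "\<And>x t. f (x, t) \<noteq> 0 \<or> g (x, t) \<noteq> 0 \<Longrightarrow> \<bar>x\<bar> < R \<and> 0 < t \<and> t < R"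
    and N: "R \<le> time_level r h N" and K: "R + h \<le> of_int K * h"
  defines "F \<equiv> \<lambda>z. step_function r h a z * f z + step_function r h b z * g z"
  shows "set_integrable lborel half_plane F"
    and "(LINT z:half_plane|lborel. F z) = (\<Sum>n<N. \<Sum>i\<in>{-K..K}.
      a n i * (LINT z:space_time_cell r h n i|lborel. f z)
      + b n i * (LINT z:space_time_cell r h n i|lborel. g z))"
proof -
  let ?Q = "space_time_cell r h"
  let ?J = "{..<N} \<times> {-K..K}"
  have cell: "set_integrable lborel (?Q n i) f" "set_integrable lborel (?Q n i) g" for n i
    by (rule set_integrable_space_time_cell[OF rh]; fact)+
  have split: "indicat_real half_plane z *\<^sub>R F z = (\<Sum>(n, i)\<in>?J.
      a n i * (indicat_real (?Q n i) z *\<^sub>R f z) + b n i * (indicat_real (?Q n i) z *\<^sub>R g z))" for z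
  proof (cases "f z = 0 \<and> g z = 0")
    case True
    then show ?thesis by (auto simp: F_def)
  next
    case False
    obtain x t where z: "z = (x, t)" by force
    define i n where "i = \<lfloor>x / h + 1 / 2\<rfloor>" and "n = nat \<lfloor>t / (r * h)\<rfloor>"
    have xt: "\<bar>x\<bar> < R" "0 < t" "t < R" using supp False z by blast+
    have fl: "\<lfloor>t / (r * h)\<rfloor> = int n" using xt(2) rh by (simp add: n_def)
    have mem: "z \<in> ?Q m j \<longleftrightarrow> (m, j) = (n, i)" for m j
      unfolding z in_space_time_cell_iff[OF rh] fl i_def by auto
    have zQ: "(x, t) \<in> ?Q n i" using mem z by simp
    have "time_level r h n < time_level r h N"
      using zQ xt(3) N by (auto simp: space_time_cell_def)
    then have "n < N" using rh by (simp add: time_level_def)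
    moreover have "of_int i * h < (of_int K + 1 / 2) * h" "(- of_int K - 1 / 2) * h < of_int i * h"
      using zQ xt(1) K rh by (auto simp: space_time_cell_def algebra_simps abs_less_iff)
    then have "of_int i < of_int K + (1 / 2 :: real)" "- of_int K - (1 / 2 :: real) < of_int i"
      using rh by (simp_all only: mult_less_cancel_right_pos)
    then have "i < K + 1" "- K - 1 < i" by linarith+
    ultimately have J: "(n, i) \<in> ?J" by auto
    have "indicat_real half_plane z *\<^sub>R F z = a n i * f z + b n i * g z"
      using xt(2) by (simp add: z half_plane_def F_def step_function_def i_def n_def)
    also have "\<dots> = (\<Sum>(n, i)\<in>{(n, i)}.
      a n i * (indicat_real (?Q n i) z *\<^sub>R f z) + b n i * (indicat_real (?Q n i) z *\<^sub>R g z))"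
      by (simp add: mem)
    also have "\<dots> = (\<Sum>(n, i)\<in>?J.
      a n i * (indicat_real (?Q n i) z *\<^sub>R f z) + b n i * (indicat_real (?Q n i) z *\<^sub>R g z))"
      using J by (intro sum.mono_neutral_left) (auto simp: mem indicator_def of_bool_def split: if_splits)
    finally show ?thesis .
  qed
  have int: "integrable lborel (\<lambda>z. a n i * (indicat_real (?Q n i) z *\<^sub>R f z)
      + b n i * (indicat_real (?Q n i) z *\<^sub>R g z))" for n i
    using cell[of n i] unfolding set_integrable_def
    by (intro Bochner_Integration.integrable_add Bochner_Integration.integrable_mult_right) auto
  show "set_integrable lborel half_plane F"
    unfolding set_integrable_def split
    by (rule Bochner_Integration.integrable_sum) (use int in auto)
  have "(LINT z:half_plane|lborel. F z) = (\<Sum>(n, i)\<in>?J. LINT z|lborel. a n i * (indicat_real (?Q n i) z *\<^sub>R f z)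
      + b n i * (indicat_real (?Q n i) z *\<^sub>R g z))"
    unfolding set_lebesgue_integral_def split
    by (subst Bochner_Integration.integral_sum) (use int in \<open>auto intro!: sum.cong\<close>)
  also have "\<dots> = (\<Sum>(n, i)\<in>?J. a n i * (LINT z:?Q n i|lborel. f z) + b n i * (LINT z:?Q n i|lborel. g z))"
  proof (intro sum.cong refl, clarify)
    fix n i
    show "(LINT z|lborel. a n i * (indicat_real (?Q n i) z *\<^sub>R f z) + b n i * (indicat_real (?Q n i) z *\<^sub>R g z))
      = a n i * (LINT z:?Q n i|lborel. f z) + b n i * (LINT z:?Q n i|lborel. g z)"
      using cell[of n i] unfolding set_lebesgue_integral_def set_integrable_def
      by (subst Bochner_Integration.integral_add) auto
  qed
  finally show "(LINT z:half_plane|lborel. F z) = (\<Sum>n<N. \<Sum>i\<in>{-K..K}.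
      a n i * (LINT z:?Q n i|lborel. f z) + b n i * (LINT z:?Q n i|lborel. g z))"
    by (simp add: sum.cartesian_product)
qed

lemma step_function_weak_form_integrable:
  assumes rh: "r > 0" "h > 0" and \<phi>: "\<phi> \<in> test_functions half_plane"
  shows "set_integrable lborel half_plane
    (\<lambda>z. step_function r h a z * dt \<phi> z + step_function r h b z * dx \<phi> z)"
proof -
  obtain R where R: "\<And>x t. \<phi> (x, t) \<noteq> 0 \<or> dt \<phi> (x, t) \<noteq> 0 \<or> dx \<phi> (x, t) \<noteq> 0 \<Longrightarrow> \<bar>x\<bar> < R \<and> 0 < t \<and> t < R"
    using test_function_half_plane_constants[OF \<phi>] by metis
  note D = test_function_partial_derivatives(3,4)[OF \<phi>]
  obtain N where "R / (r * h) \<le> real N" using real_arch_simple by blast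
  then have N: "R \<le> time_level r h N" using rh by (simp add: time_level_def field_simps)
  obtain K where "R / h + 1 \<le> of_int K" using ex_le_of_int by blast
  then have K: "R + h \<le> of_int K * h" using rh by (simp add: field_simps)
  show ?thesis
    by (rule step_function_integral(1)[OF rh _ _ _ N K])
       (use test_function_continuous_on D R in blast)+
qed

section \<open>The weak form along the scheme\<close>

text \<open>The local error of the weak form on one space-time cell. The time derivative is compared with
  the difference of \<open>\<phi>\<close> between the two time levels, and the space derivative with its value at
  the later level, where the adjoint step evaluates it. Each comparison costs a factor \<open>O(h)\<close> on a cell
  of area \<open>r * h\<^sup>2\<close>, so the error is \<open>O(h\<^sup>3)\<close> times the cell value.\<close>

lemma cell_weak_form_error:
  fixes i :: int and w :: real
  assumes rh: "r > 0" "h > 0" and \<phi>: "\<phi> \<in> test_functions half_plane"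
    and u: "\<bar>r * u\<bar> \<le> 1 / 2" and L: "L \<ge> 0"
    and Lt: "\<And>x t y s. \<bar>dt \<phi> (x, t) - dt \<phi> (y, s)\<bar> \<le> L * (\<bar>x - y\<bar> + \<bar>t - s\<bar>)"
    and Lx: "\<And>x t y s. \<bar>dx \<phi> (x, t) - dx \<phi> (y, s)\<bar> \<le> L * (\<bar>x - y\<bar> + \<bar>t - s\<bar>)"
  defines "x \<equiv> real_of_int i * h" and "t \<equiv> time_level r h"
  shows "\<bar>w * (LINT z:space_time_cell r h n i|lborel. dt \<phi> z)
      + u * w * (LINT z:space_time_cell r h n i|lborel. dx \<phi> z)
      - h * ((\<phi> (x, t (Suc n)) - \<phi> (x, t n) + r * u * h * dx \<phi> (x, t (Suc n))) * w)\<bar>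
    \<le> L * (1 / 2 + 2 * r) * (r + 1 / 2) * h ^ 3 * \<bar>w\<bar>"
proof -
  let ?Q = "space_time_cell r h n i"
  define It Ix where "It = (LINT z:?Q|lborel. dt \<phi> z)" and "Ix = (LINT z:?Q|lborel. dx \<phi> z)"
  define e where "e = h * (r * h) * (L * (h / 2 + 2 * (r * h)))"
  note D = test_function_partial_derivatives[OF \<phi>]
  have tau: "t (Suc n) = t n + r * h" by (simp add: t_def time_level_def algebra_simps)
  have near: "\<bar>y - x\<bar> \<le> h / 2" "\<bar>s - t n\<bar> \<le> r * h" "\<bar>s - t (Suc n)\<bar> \<le> r * h" if "(y, s) \<in> ?Q" for y s
  proof -
    have "x - h / 2 \<le> y" "y < x + h / 2" "t n \<le> s" "s < t (Suc n)"
      using that by (auto simp: space_time_cell_def x_def t_def)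
    then show "\<bar>y - x\<bar> \<le> h / 2" "\<bar>s - t n\<bar> \<le> r * h" "\<bar>s - t (Suc n)\<bar> \<le> r * h"
      using tau by linarith+
  qed
  have "\<bar>It - h * (r * h) * dt \<phi> (x, t n)\<bar> \<le> h * (r * h) * (L * (h / 2 + r * h))"
    unfolding It_def
  proof (rule space_time_cell_integral_approx[OF rh])
    show "continuous_on UNIV (dt \<phi>)" by (rule test_function_continuous_on[OF D(4)])
    show "\<bar>dt \<phi> z - dt \<phi> (x, t n)\<bar> \<le> L * (h / 2 + r * h)" if "z \<in> ?Q" for z
      using that near L by (cases z) (auto intro!: order_trans[OF Lt] mult_left_mono add_mono)
  qed
  moreover have "\<bar>\<phi> (x, t n + r * h) - \<phi> (x, t n) - r * h * dt \<phi> (x, t n)\<bar> \<le> L * (r * h)\<^sup>2"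
    by (rule lipschitz_derivative_taylor[where f = "\<lambda>s. \<phi> (x, s)", OF D(2) _ L])
       (use Lt[of x _ x] in simp)
  then have "\<bar>h * (\<phi> (x, t (Suc n)) - \<phi> (x, t n)) - h * (r * h) * dt \<phi> (x, t n)\<bar> \<le> h * (L * (r * h)\<^sup>2)"
    using rh unfolding tau
    by (subst abs_mult_pos[of h, symmetric] | simp add: right_diff_distrib[symmetric] abs_mult mult.assoc)+
  moreover have "h * (r * h) * (L * (h / 2 + r * h)) + h * (L * (r * h)\<^sup>2) = e"
    by (simp add: e_def power2_eq_square algebra_simps)
  ultimately have It: "\<bar>It - h * (\<phi> (x, t (Suc n)) - \<phi> (x, t n))\<bar> \<le> e" by linarith
  have "\<bar>Ix - h * (r * h) * dx \<phi> (x, t (Suc n))\<bar> \<le> h * (r * h) * (L * (h / 2 + r * h))"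
    unfolding Ix_def
  proof (rule space_time_cell_integral_approx[OF rh])
    show "continuous_on UNIV (dx \<phi>)" by (rule test_function_continuous_on[OF D(3)])
    show "\<bar>dx \<phi> z - dx \<phi> (x, t (Suc n))\<bar> \<le> L * (h / 2 + r * h)" if "z \<in> ?Q" for z
      using that near L by (cases z) (auto intro!: order_trans[OF Lx] mult_left_mono add_mono)
  qed
  also have "\<dots> \<le> e"
    unfolding e_def using rh L by (intro mult_left_mono) auto
  finally have Ix: "\<bar>Ix - h * (r * h) * dx \<phi> (x, t (Suc n))\<bar> \<le> e" .
  have "w * It + u * w * Ix
      - h * ((\<phi> (x, t (Suc n)) - \<phi> (x, t n) + r * u * h * dx \<phi> (x, t (Suc n))) * w)
    = w * ((It - h * (\<phi> (x, t (Suc n)) - \<phi> (x, t n)))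
        + u * (Ix - h * (r * h) * dx \<phi> (x, t (Suc n))))"
    by (simp add: algebra_simps)
  also have "\<bar>\<dots>\<bar> \<le> \<bar>w\<bar> * (e + \<bar>u\<bar> * e)"
    unfolding abs_mult[of w] using It Ix
    by (intro mult_left_mono order_trans[OF abs_triangle_ineq] add_mono) (auto simp: abs_mult intro: mult_left_mono)
  also have "\<dots> = \<bar>w\<bar> * (L * (1 / 2 + 2 * r) * h ^ 3 * (r + r * \<bar>u\<bar>))"
    by (simp add: e_def power3_eq_cube algebra_simps)
  also have "\<dots> \<le> \<bar>w\<bar> * (L * (1 / 2 + 2 * r) * h ^ 3 * (r + 1 / 2))"
    using u rh L by (intro mult_left_mono add_left_mono) (auto simp: abs_mult)
  finally show ?thesis by (simp add: It_def Ix_def mult_ac)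
qed

text \<open>The rate for any density \<open>w\<close> carried by a velocity field \<open>u\<close> that obeys the Courant bound.
  Since \<open>u\<close> need not be tied to \<open>w\<close>, both equations of the system are instances; the
  first one is the case \<open>w = u\<close>. The constant must not depend on \<open>h\<close>, \<open>u\<close> and \<open>w\<close>, hence it is
  obtained before them. The pairing \<open>S n\<close> of \<open>w n\<close> with the samples of \<open>\<phi>\<close> at time level \<open>n\<close>
  telescopes, and it vanishes at the first and the last level by the support of \<open>\<phi>\<close>.\<close>

lemma averaging_transport_weak_error:
  assumes r: "r > 0" and \<alpha>: "0 \<le> \<alpha>" "\<alpha> < 1 / 2" and \<phi>: "\<phi> \<in> test_functions half_plane"
  obtains C where "C \<ge> 0" and "\<And>h u w. \<lbrakk>0 < h; h \<le> 1; \<And>n i. \<bar>r * u n i\<bar> \<le> 1 / 2; w 0 summable_on UNIV;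
      \<And>n. w (Suc n) = averaging \<alpha> (transport r (u n) (w n))\<rbrakk> \<Longrightarrow>
    \<bar>LINT z:half_plane|lborel. step_function r h w z * dt \<phi> z
      + step_function r h (\<lambda>n i. u n i * w n i) z * dx \<phi> z\<bar> \<le> C * (h * (\<Sum>\<^sub>\<infinity>i. \<bar>w 0 i\<bar>)) * h"
proof -
  obtain R L where R: "R > 0"
      "\<And>x t. \<phi> (x, t) \<noteq> 0 \<or> dt \<phi> (x, t) \<noteq> 0 \<or> dx \<phi> (x, t) \<noteq> 0 \<Longrightarrow> \<bar>x\<bar> < R \<and> 0 < t \<and> t < R"
    and L: "L \<ge> 0"
      "\<And>x t y s. \<bar>dt \<phi> (x, t) - dt \<phi> (y, s)\<bar> \<le> L * (\<bar>x - y\<bar> + \<bar>t - s\<bar>)"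
      "\<And>x t y s. \<bar>dx \<phi> (x, t) - dx \<phi> (y, s)\<bar> \<le> L * (\<bar>x - y\<bar> + \<bar>t - s\<bar>)"
    using test_function_half_plane_constants[OF \<phi>] by blast
  obtain B where B: "\<And>z. \<bar>\<phi> z\<bar> \<le> B" using test_function_bounded[OF \<phi>] by blast
  note D = test_function_partial_derivatives[OF \<phi>]
  define c where "c = L * (1 / 2 + 2 * r) * (r + 1 / 2)"
  have c: "c \<ge> 0" using L r by (simp add: c_def)
  define C where "C = (R / r + 1) * (c + 2 * L)"
  show ?thesis
  proof (rule that[of C])
    show "C \<ge> 0" unfolding C_def using R r c L by auto
    fix h :: real and u w :: "nat \<Rightarrow> int \<Rightarrow> real"
    assume h: "0 < h" "h \<le> 1" and u: "\<And>n i. \<bar>r * u n i\<bar> \<le> 1 / 2" and w0: "w 0 summable_on UNIV"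
      and w: "\<And>n. w (Suc n) = averaging \<alpha> (transport r (u n) (w n))"
    let ?Q = "space_time_cell r h"
    define A where "A = (\<Sum>\<^sub>\<infinity>i. \<bar>w 0 i\<bar>)"
    have A0: "A \<ge> 0" unfolding A_def by (rule infsum_nonneg) simp
    have u1: "\<bar>r * u n i\<bar> \<le> 1" for n i using u[of n i] by linarith
    have wn: "w n summable_on UNIV" and wA: "(\<Sum>\<^sub>\<infinity>i. \<bar>w n i\<bar>) \<le> A" for n
      unfolding A_def using averaging_transport_iterates[of \<alpha> r u w n, OF \<alpha> u1 w0 w] by blast+
    \<comment> \<open>Beyond time level \<open>N\<close> and outside the cells \<open>{-K..K}\<close> the test function vanishes; the bound
      on \<open>N * h\<close> is what turns local errors of order \<open>h ^ 3\<close> into a global error of order \<open>h\<close>.\<close>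
    define N where "N = nat \<lceil>R / (r * h)\<rceil>"
    define K where "K = \<lceil>R / h\<rceil> + 1"
    have N': "R / (r * h) \<le> real N" "real N \<le> R / (r * h) + 1"
      using R(1) r h by (auto simp: N_def)
    have "real N * h \<le> (R / (r * h) + 1) * h" using N'(2) h by (intro mult_right_mono) auto
    also have "\<dots> = R / r + h" using h by (simp add: field_simps)
    also have "\<dots> \<le> R / r + 1" using h by simp
    finally have Nh: "real N * h \<le> R / r + 1" .
    have N: "R \<le> time_level r h N"
      using N'(1) r h by (simp add: time_level_def field_simps)
    have "R / h + 1 \<le> of_int K" by (simp add: K_def)
    then have K: "R + h \<le> of_int K * h" using h by (simp add: field_simps)
    define g where "g n i = \<phi> (of_int i * h, time_level r h n)" for n and i :: int
    \<comment> \<open>A discrete \<open>dt \<phi> + u * dx \<phi>\<close>, times the time step \<open>r * h\<close>.\<close>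
    define G where "G n i = g (Suc n) i - g n i
      + r * u n i * h * dx \<phi> (of_int i * h, time_level r h (Suc n))" for n i
    define S where "S n = (\<Sum>\<^sub>\<infinity>i. g n i * w n i)" for n
    have G0: "G n i = 0" if "i \<notin> {-K..K}" for n i
    proof -
      have "of_int K * h \<le> \<bar>of_int i\<bar> * h"
        using that h by (intro mult_right_mono) (auto simp: abs_if)
      moreover have "\<bar>of_int i * h\<bar> = \<bar>of_int i\<bar> * h" using h by (simp add: abs_mult)
      ultimately have "\<not> \<bar>of_int i * h\<bar> < R" using K h by linarith
      then have "\<phi> (of_int i * h, s) = 0" "dx \<phi> (of_int i * h, s) = 0" for s
        using R(2) by blast+
      then show ?thesis by (simp add: G_def g_def)
    qed
    have Gw: "G n i * w n i = 0" if "i \<notin> {-K..K}" for n i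
      using G0[OF that] by simp
    have Gs: "(\<lambda>i. G n i * w n i) summable_on UNIV" for n
      by (rule finite_nonzero_values_imp_summable_on, rule finite_subset[of _ "{-K..K}"])
         (use Gw in blast, simp)
    have Gsum: "(\<Sum>\<^sub>\<infinity>i. G n i * w n i) = (\<Sum>i\<in>{-K..K}. G n i * w n i)" for n
      using infsum_cong_neutral[of "{-K..K}" UNIV "\<lambda>i. G n i * w n i" "\<lambda>i. G n i * w n i"] Gw
      by auto
    have time_step: "\<bar>(\<Sum>i\<in>{-K..K}. G n i * w n i) - (S (Suc n) - S n)\<bar> \<le> 2 * L * h\<^sup>2 * A" for n
    proof -
      define E where "E i = transport_adjoint r (u n) (averaging \<alpha> (g (Suc n))) i
        - (g (Suc n) i + r * u n i * h * dx \<phi> (of_int i * h, time_level r h (Suc n)))" for i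
      have E: "\<bar>E i\<bar> \<le> 2 * L * h\<^sup>2" for i
        unfolding E_def g_def
        by (rule transport_adjoint_consistent[where f = "\<lambda>x. \<phi> (x, time_level r h (Suc n))", OF D(1) _ L(1) \<alpha> u1])
           (use L(3)[of _ "time_level r h (Suc n)" _ "time_level r h (Suc n)"] in simp)
      have gs: "(\<lambda>i. g n i * w n i) summable_on UNIV"
        by (rule summable_on_mult_bounded[OF wn, where B = B]) (simp add: g_def B)
      have Es: "(\<lambda>i. E i * w n i) summable_on UNIV"
        by (rule summable_on_mult_bounded[OF wn E])
      have "S (Suc n) = (\<Sum>\<^sub>\<infinity>i. transport_adjoint r (u n) (averaging \<alpha> (g (Suc n))) i * w n i)"
        unfolding S_def w
        by (rule averaging_transport_adjoint(2)[OF \<alpha> u1 wn, where B = B]) (simp add: g_def B)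
      also have "\<dots> = (\<Sum>\<^sub>\<infinity>i. E i * w n i + G n i * w n i + g n i * w n i)"
        by (rule infsum_cong) (simp add: E_def G_def algebra_simps)
      also have "\<dots> = (\<Sum>\<^sub>\<infinity>i. E i * w n i) + (\<Sum>\<^sub>\<infinity>i. G n i * w n i) + S n"
        unfolding S_def
        by (simp only: infsum_add[OF summable_on_add[OF Es Gs] gs] infsum_add[OF Es Gs])
      finally have "\<bar>(\<Sum>i\<in>{-K..K}. G n i * w n i) - (S (Suc n) - S n)\<bar> = \<bar>\<Sum>\<^sub>\<infinity>i. E i * w n i\<bar>"
        by (simp add: Gsum)
      also have "\<dots> \<le> 2 * L * h\<^sup>2 * (\<Sum>\<^sub>\<infinity>i. \<bar>w n i\<bar>)"
        by (rule infsum_mult_bounded[OF wn E])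
      also have "\<dots> \<le> 2 * L * h\<^sup>2 * A"
        using L(1) by (intro mult_left_mono wA) auto
      finally show ?thesis .
    qed
    define T where "T n i = w n i * (LINT z:?Q n i|lborel. dt \<phi> z)
      + u n i * w n i * (LINT z:?Q n i|lborel. dx \<phi> z)" for n i
    have cells: "\<bar>(\<Sum>i\<in>{-K..K}. T n i) - h * (\<Sum>i\<in>{-K..K}. G n i * w n i)\<bar> \<le> c * h ^ 3 * A" for n
    proof -
      have "\<bar>(\<Sum>i\<in>{-K..K}. T n i) - h * (\<Sum>i\<in>{-K..K}. G n i * w n i)\<bar>
          \<le> (\<Sum>i\<in>{-K..K}. \<bar>T n i - h * (G n i * w n i)\<bar>)"
        unfolding sum_distrib_left sum_subtractf[symmetric] by (rule sum_abs)
      also have "\<dots> \<le> (\<Sum>i\<in>{-K..K}. c * h ^ 3 * \<bar>w n i\<bar>)"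
        unfolding T_def G_def g_def c_def
        by (intro sum_mono cell_weak_form_error[OF r h(1) \<phi> u L])
      also have "\<dots> = c * h ^ 3 * (\<Sum>i\<in>{-K..K}. \<bar>w n i\<bar>)" by (simp add: sum_distrib_left)
      also have "\<dots> \<le> c * h ^ 3 * A"
      proof (rule mult_left_mono)
        have "(\<Sum>i\<in>{-K..K}. \<bar>w n i\<bar>) \<le> (\<Sum>\<^sub>\<infinity>i. \<bar>w n i\<bar>)"
          by (intro finite_sum_le_infsum summable_on_abs wn) auto
        then show "(\<Sum>i\<in>{-K..K}. \<bar>w n i\<bar>) \<le> A" using wA order_trans by blast
        show "0 \<le> c * h ^ 3" using c h by simp
      qed
      finally show ?thesis .
    qed
    have step: "\<bar>(\<Sum>i\<in>{-K..K}. T n i) - h * (S (Suc n) - S n)\<bar> \<le> (c + 2 * L) * h ^ 3 * A" for n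
    proof -
      have "\<bar>h * (\<Sum>i\<in>{-K..K}. G n i * w n i) - h * (S (Suc n) - S n)\<bar> \<le> h * (2 * L * h\<^sup>2 * A)"
        unfolding right_diff_distrib[symmetric] abs_mult using time_step[of n] h by simp
      also have "\<dots> = 2 * L * h ^ 3 * A" by (simp add: power2_eq_square power3_eq_cube)
      finally show ?thesis using cells[of n] by (simp add: algebra_simps)
    qed
    have "time_level r h 0 = 0" by (simp add: time_level_def)
    then have "g 0 i = 0" "g N i = 0" for i
      unfolding g_def using R(2) N by (metis less_irrefl, metis not_less)
    then have S: "S 0 = 0" "S N = 0" by (simp_all add: S_def)
    have "(LINT z:half_plane|lborel. step_function r h w z * dt \<phi> z
      + step_function r h (\<lambda>n i. u n i * w n i) z * dx \<phi> z) = (\<Sum>n<N. \<Sum>i\<in>{-K..K}. T n i)"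
      unfolding T_def
      by (rule step_function_integral(2)[OF r h(1) _ _ _ N K])
         (use test_function_continuous_on D(3,4) R(2) in blast)+
    also have "\<dots> = (\<Sum>n<N. \<Sum>i\<in>{-K..K}. T n i) - h * (\<Sum>n<N. S (Suc n) - S n)"
      by (simp add: sum_lessThan_telescope S)
    also have "\<dots> = (\<Sum>n<N. (\<Sum>i\<in>{-K..K}. T n i) - h * (S (Suc n) - S n))"
      by (simp only: sum_distrib_left sum_subtractf[symmetric])
    also have "\<bar>\<dots>\<bar> \<le> (\<Sum>n<N. (c + 2 * L) * h ^ 3 * A)"
      by (rule order_trans[OF sum_abs]) (intro sum_mono step)
    \<comment> \<open>One factor \<open>h\<close> pays for the number of steps, one for the \<open>l1\<close> norm, one remains.\<close>
    also have "\<dots> = (real N * h) * ((c + 2 * L) * h\<^sup>2 * A)"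
      by (simp add: power2_eq_square power3_eq_cube)
    also have "\<dots> \<le> (R / r + 1) * ((c + 2 * L) * h\<^sup>2 * A)"
      using Nh c L A0 by (intro mult_right_mono) auto
    also have "\<dots> = C * (h * A) * h" by (simp add: C_def power2_eq_square)
    finally show "\<bar>LINT z:half_plane|lborel. step_function r h w z * dt \<phi> z
      + step_function r h (\<lambda>n i. u n i * w n i) z * dx \<phi> z\<bar> \<le> C * (h * (\<Sum>\<^sub>\<infinity>i. \<bar>w 0 i\<bar>)) * h"
      unfolding A_def .
  qed
qed

theorem mainTheorem2:
  fixes u0 v0 :: "real \<Rightarrow> real" and r \<alpha> :: real
  assumes "integrable lebesgue u0" and "Linf_norm u0 < \<infinity>"
    and "integrable lebesgue v0"
    and "0 \<le> \<alpha>" and "\<alpha> < 1 / 2"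
    and "r > 0" and "ereal r * Linf_norm u0 \<le> ereal (1 / 2)"
  shows "\<forall>\<phi> \<in> test_functions half_plane. \<forall>\<psi> \<in> test_functions half_plane.
      (\<forall>h>0. set_integrable lborel half_plane (integrand_u r \<alpha> u0 \<phi> h)) \<and>
      (\<forall>h>0. set_integrable lborel half_plane (integrand_v r \<alpha> u0 v0 \<psi> h)) \<and>
      (\<lambda>h. LINT z:half_plane|lborel. integrand_u r \<alpha> u0 \<phi> h z) \<in> O[at_right 0](\<lambda>h. h) \<and>
      (\<lambda>h. LINT z:half_plane|lborel. integrand_v r \<alpha> u0 v0 \<psi> h z) \<in> O[at_right 0](\<lambda>h. h) \<and>
      ((\<lambda>h. LINT z:half_plane|lborel. integrand_u r \<alpha> u0 \<phi> h z) \<longlongrightarrow> 0) (at_right 0) \<and>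
      ((\<lambda>h. LINT z:half_plane|lborel. integrand_v r \<alpha> u0 v0 \<psi> h z) \<longlongrightarrow> 0) (at_right 0)"
proof (intro ballI)
  fix \<phi> \<psi> assume \<phi>: "\<phi> \<in> test_functions half_plane" and \<psi>: "\<psi> \<in> test_functions half_plane"
  let ?u = "scheme_u r \<alpha> u0" and ?v = "scheme_v r \<alpha> u0 v0"
  have iu: "integrand_u r \<alpha> u0 \<phi> h = (\<lambda>z. step_function r h (?u h) z * dt \<phi> z
      + step_function r h (\<lambda>n i. ?u h n i * ?u h n i) z * dx \<phi> z)" for h
    by (auto simp: integrand_u_def step_u_def step_function_def power2_eq_square)
  have iv: "integrand_v r \<alpha> u0 v0 \<psi> h = (\<lambda>z. step_function r h (?v h) z * dt \<psi> z
      + step_function r h (\<lambda>n i. ?u h n i * ?v h n i) z * dx \<psi> z)" for h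
    by (auto simp: integrand_v_def step_u_def step_v_def step_function_def)
  have linear_rate: "f \<in> O[at_right 0](\<lambda>h. h) \<and> (f \<longlongrightarrow> 0) (at_right 0)"
    if "\<And>h. 0 < h \<Longrightarrow> h \<le> 1 \<Longrightarrow> \<bar>f h\<bar> \<le> C * h" for f :: "real \<Rightarrow> real" and C
  proof
    have ev: "eventually (\<lambda>h. \<bar>f h\<bar> \<le> C * h) (at_right 0)"
      using that by (auto simp: eventually_at_right_field intro!: exI[of _ 1])
    show "f \<in> O[at_right 0](\<lambda>h. h)"
      by (intro bigoI[of _ C], use ev eventually_at_right_less[of 0] in eventually_elim) auto
    show "(f \<longlongrightarrow> 0) (at_right 0)"
    proof (rule Lim_null_comparison)
      show "eventually (\<lambda>h. norm (f h) \<le> C * h) (at_right 0)" using ev by simp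
      show "((\<lambda>h. C * h) \<longlongrightarrow> 0) (at_right 0)" by (auto intro!: tendsto_eq_intros)
    qed
  qed
  have rate: "(\<lambda>h. LINT z:half_plane|lborel. step_function r h (w h) z * dt \<eta> z
        + step_function r h (\<lambda>n i. ?u h n i * w h n i) z * dx \<eta> z) \<in> O[at_right 0](\<lambda>h. h) \<and>
      ((\<lambda>h. LINT z:half_plane|lborel. step_function r h (w h) z * dt \<eta> z
        + step_function r h (\<lambda>n i. ?u h n i * w h n i) z * dx \<eta> z) \<longlongrightarrow> 0) (at_right 0)"
    if \<eta>: "\<eta> \<in> test_functions half_plane" and w0: "integrable lebesgue w0"
      and init: "\<And>h. w h 0 = cell_average h w0"
      and step: "\<And>h n. w h (Suc n) = averaging \<alpha> (transport r (?u h n) (w h n))"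
    for \<eta> w0 and w :: "real \<Rightarrow> nat \<Rightarrow> int \<Rightarrow> real"
  proof -
    obtain C where C: "C \<ge> 0" "\<And>h u w. \<lbrakk>0 < h; h \<le> 1; \<And>n i. \<bar>r * u n i\<bar> \<le> 1 / 2; w 0 summable_on UNIV;
        \<And>n. w (Suc n) = averaging \<alpha> (transport r (u n) (w n))\<rbrakk> \<Longrightarrow>
      \<bar>LINT z:half_plane|lborel. step_function r h w z * dt \<eta> z
        + step_function r h (\<lambda>n i. u n i * w n i) z * dx \<eta> z\<bar> \<le> C * (h * (\<Sum>\<^sub>\<infinity>i. \<bar>w 0 i\<bar>)) * h"
      using averaging_transport_weak_error[OF assms(6,4,5) \<eta>] by blast
    show ?thesis
    proof (rule linear_rate[where C = "C * (LINT x|lebesgue. \<bar>w0 x\<bar>)"])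
      fix h :: real assume h: "0 < h" "h \<le> 1"
      note avg = cell_average_summable[OF w0 h(1), folded init]
      have "\<bar>LINT z:half_plane|lborel. step_function r h (w h) z * dt \<eta> z
          + step_function r h (\<lambda>n i. ?u h n i * w h n i) z * dx \<eta> z\<bar>
        \<le> C * (h * (\<Sum>\<^sub>\<infinity>i. \<bar>w h 0 i\<bar>)) * h"
        by (rule C(2)[OF h _ avg(1) step]) (rule scheme_u_bounded[OF assms(1,4,5,6,7) h(1)])
      also have "\<dots> \<le> C * (LINT x|lebesgue. \<bar>w0 x\<bar>) * h"
        using C(1) h(1) avg(2) by (intro mult_right_mono mult_left_mono) auto
      finally show "\<bar>LINT z:half_plane|lborel. step_function r h (w h) z * dt \<eta> z
          + step_function r h (\<lambda>n i. ?u h n i * w h n i) z * dx \<eta> z\<bar>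
        \<le> C * (LINT x|lebesgue. \<bar>w0 x\<bar>) * h" .
    qed
  qed
  show "(\<forall>h>0. set_integrable lborel half_plane (integrand_u r \<alpha> u0 \<phi> h)) \<and>
      (\<forall>h>0. set_integrable lborel half_plane (integrand_v r \<alpha> u0 v0 \<psi> h)) \<and>
      (\<lambda>h. LINT z:half_plane|lborel. integrand_u r \<alpha> u0 \<phi> h z) \<in> O[at_right 0](\<lambda>h. h) \<and>
      (\<lambda>h. LINT z:half_plane|lborel. integrand_v r \<alpha> u0 v0 \<psi> h z) \<in> O[at_right 0](\<lambda>h. h) \<and>
      ((\<lambda>h. LINT z:half_plane|lborel. integrand_u r \<alpha> u0 \<phi> h z) \<longlongrightarrow> 0) (at_right 0) \<and>
      ((\<lambda>h. LINT z:half_plane|lborel. integrand_v r \<alpha> u0 v0 \<psi> h z) \<longlongrightarrow> 0) (at_right 0)"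
    unfolding iu iv
    using step_function_weak_form_integrable[OF assms(6) _ \<phi>]
      step_function_weak_form_integrable[OF assms(6) _ \<psi>]
      rate[OF \<phi> assms(1), of ?u] rate[OF \<psi> assms(3), of ?v]
    by simp
qed

end
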